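(* Let $n\ge 3$ be an integer. Every local automorphism of the special unitary group $SU_n(\mathbb C)$ is an automorphism of the group $SU_n(\mathbb C)$.
   Context: A map $\phi: G\to G$ on a group $G$ (no algebraic property or bijectivity assumed) is called a local automorphism of $G$ if for every pair $a,b\in G$ there exists a group automorphism $\phi_{a,b}:G\to G$ (depending on $a,b$) such that $\phi(a)=\phi_{a,b}(a)$ and $\phi(b)=\phi_{a,b}(b)$. Automorphisms are abstract group automorphisms (no continuity assumed). $SU_n(\mathbb C)$ is the group of $n\times n$ complex unitary matrices with determinant $1$. *)

theory Defs
  imports "HOL-Analysis.Analysis" "HOL-Algebra.Group"
begin

definition adjoint_matrix :: "complex^'n^'m \<Rightarrow> complex^'m^'n" where
  "adjoint_matrix A = (\<chi> i j. cnj (A $ j $ i))"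

definition unitary_matrix :: "complex^'n^'n \<Rightarrow> bool" where
  "unitary_matrix A \<longleftrightarrow>
     adjoint_matrix A ** A = mat 1 \<and> A ** adjoint_matrix A = mat 1"

text \<open>The size of the matrices is the cardinality of the index type.\<close>

definition special_unitary_group :: "(complex^'n^'n) monoid" where
  "special_unitary_group =
     \<lparr>carrier = {A. unitary_matrix A \<and> det A = 1}, mult = (**), one = mat 1\<rparr>"

text \<open>The value of a map outside the carrier is irrelevant; an automorphism of \<open>G\<close> is an
  element of \<^term>\<open>iso G G\<close>, i.e. a homomorphism that is bijective on the carrier.\<close>

definition local_automorphism :: "('a, 'b) monoid_scheme \<Rightarrow> ('a \<Rightarrow> 'a) \<Rightarrow> bool" where
  "local_automorphism G \<phi> \<longleftrightarrow>
     \<phi> \<in> carrier G \<rightarrow> carrier G \<and>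
     (\<forall>a \<in> carrier G. \<forall>b \<in> carrier G. \<exists>\<psi> \<in> iso G G. \<phi> a = \<psi> a \<and> \<phi> b = \<psi> b)"

lemma adjoint_matrix_mult:
  "adjoint_matrix (A ** B) = adjoint_matrix B ** adjoint_matrix A"
  by (simp add: adjoint_matrix_def matrix_matrix_mult_def vec_eq_iff mult.commute)

lemma adjoint_matrix_adjoint_matrix [simp]: "adjoint_matrix (adjoint_matrix A) = A"
  by (simp add: adjoint_matrix_def vec_eq_iff)

lemma adjoint_matrix_one [simp]: "adjoint_matrix (mat 1) = mat 1"
  by (auto simp: adjoint_matrix_def mat_def vec_eq_iff)

lemma unitary_matrix_mult:
  assumes "unitary_matrix A" "unitary_matrix B"
  shows "unitary_matrix (A ** B)"
proof -
  have "(adjoint_matrix B ** adjoint_matrix A) ** (A ** B)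
      = adjoint_matrix B ** (adjoint_matrix A ** A) ** B"
    by (simp add: matrix_mul_assoc)
  moreover have "(A ** B) ** (adjoint_matrix B ** adjoint_matrix A)
      = A ** (B ** adjoint_matrix B) ** adjoint_matrix A"
    by (simp add: matrix_mul_assoc)
  ultimately show ?thesis
    using assms by (simp add: unitary_matrix_def adjoint_matrix_mult)
qed

lemma unitary_matrix_adjoint: "unitary_matrix A \<Longrightarrow> unitary_matrix (adjoint_matrix A)"
  by (simp add: unitary_matrix_def)

lemma group_special_unitary_group:
  "group (special_unitary_group :: (complex^'n^'n) monoid)"
proof (rule groupI)
  fix A :: "complex^'n^'n"
  assume "A \<in> carrier special_unitary_group"
  then have A: "unitary_matrix A" "det A = 1"
    by (simp_all add: special_unitary_group_def)
  have "det (adjoint_matrix A ** A) = 1"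
    using A(1) by (simp add: unitary_matrix_def)
  then have "det (adjoint_matrix A) = 1"
    using A(2) by (simp add: det_mul)
  with A show "\<exists>B \<in> carrier special_unitary_group.
      B \<otimes>\<^bsub>special_unitary_group\<^esub> A = \<one>\<^bsub>special_unitary_group\<^esub>"
    by (intro bexI[of _ "adjoint_matrix A"])
       (simp_all add: special_unitary_group_def unitary_matrix_adjoint, simp add: unitary_matrix_def)
qed (simp_all add: special_unitary_group_def unitary_matrix_mult det_mul matrix_mul_assoc,
     simp add: unitary_matrix_def)

end

theory Submission
  imports Defs "HOL-Computational_Algebra.Fundamental_Theorem_Algebra" "HOL-Real_Asymp.Real_Asymp"
begin

text \<open>An abstract automorphism \<open>\<psi>\<close> of \<open>SU\<^sub>n\<close> preserves the real part of the trace: up to conjugation it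
  maps the diagonal torus to itself, double centralizers show that it permutes the coordinates up
  to an automorphism \<open>\<beta>\<close> of the circle, and writing small rotations as commutators forces \<open>\<beta>\<close> to be
  continuous, hence the identity or complex conjugation.

  A local automorphism \<open>\<phi>\<close> therefore preserves the real inner product \<open>Re (tr (A B\<^sup>*))\<close> and extends to a
  real-linear isometry \<open>L\<close> of the full matrix algebra. Since \<open>\<phi>\<close> respects powers, \<open>L\<close> is multiplicative
  on real polynomials in a single unitary matrix; for \<open>n \<ge> 3\<close> these exhaust all matrices that are
  diagonal in a given orthonormal basis, so \<open>L\<close> is a Jordan automorphism. By Herstein's argument it is
  multiplicative or antimultiplicative, and the second case would make \<open>\<phi>\<close> reverse the relation
  \<open>B A B\<^sup>-\<^sup>1 = A\<^sup>2\<close> of a Frobenius pair, which no automorphism of \<open>SU\<^sub>n\<close> does.\<close>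

text \<open>Entrywise complex conjugation is an automorphism of SU_n, and different pairs may call
  for automorphisms with or without it. So only the real part of the trace can be controlled,
  \<open>L\<close> is linear over the reals only, and multiplication by i must be carried along as
  multiplication by a central matrix. Real polynomials in one unitary matrix then have to reach
  arbitrary complex diagonal entries, which requires nonreal eigenvalues that are pairwise neither
  equal nor conjugate; for n = 2 the determinant makes the two eigenvalues conjugate. The circle has
  many discontinuous automorphisms, so continuity must be extracted from the group structure: the
  distance from 1 of a commutator of \<open>X\<close> and \<open>G\<close> is at most twice that of
  \<open>G\<close>, whatever \<open>X\<close> is, and such a uniform bound can be transported by an
  automorphism. Isometry and compatibility with powers cannot exclude antimultiplicativity, since
  transposition has both properties. There the agreement with a single automorphism at a
  noncommuting pair is essential. Bijectivity of \<open>\<phi>\<close> is inherited from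
  \<open>L\<close>; that preimages of SU_n have determinant one needs an argument of its
  own.\<close>

subsection \<open>Eigenvectors in invariant subspaces\<close>

text \<open>This is the vector p(A) v, evaluated by Horner's scheme so that only matrix-vector
  products occur.\<close>

definition poly_apply :: "complex^'n^'n \<Rightarrow> complex^'n \<Rightarrow> complex poly \<Rightarrow> complex^'n" where
  "poly_apply A v p = fold_coeffs (\<lambda>a w. a *s v + A *v w) p 0"

lemma poly_apply_0 [simp]: "poly_apply A v 0 = 0"
  by (simp add: poly_apply_def)

lemma poly_apply_pCons [simp]: "poly_apply A v (pCons a p) = a *s v + A *v poly_apply A v p"
  by (cases "p = 0"; cases "a = 0") (auto simp: poly_apply_def)

lemma matrix_vector_mult_smult: "A *v (c *s x) = c *s (A *v x)" for A :: "complex^'n^'m"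
  by (simp add: vector_scalar_commute)

lemma poly_apply_add: "poly_apply A v (p + q) = poly_apply A v p + poly_apply A v q"
  by (induction p q rule: poly_induct2)
     (simp_all add: algebra_simps vec.scale_left_distrib)

lemma poly_apply_smult: "poly_apply A v (smult c p) = c *s poly_apply A v p"
  by (induction p) (simp_all add: matrix_vector_mult_smult vector_add_ldistrib vector_smult_assoc)

lemma poly_apply_monom: "poly_apply A v (monom c k) = c *s (((*v) A ^^ k) v)"
  by (induction k) (simp_all add: monom_0 monom_Suc matrix_vector_mult_smult)

lemma poly_apply_sum: "poly_apply A v (\<Sum>k\<in>I. f k) = (\<Sum>k\<in>I. poly_apply A v (f k))"
  by (induction I rule: infinite_finite_induct) (simp_all add: poly_apply_add)

text \<open>One more iterate of \<open>v\<close> than the real dimension forces a real linear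
  relation, whose coefficients form the polynomial. Dependence concerns the set of iterates, so a
  repeated iterate is treated separately; it yields a difference of two monomials.\<close>

lemma annihilating_poly_exists:
  fixes A :: "complex^'n^'n"
  shows "\<exists>p. p \<noteq> 0 \<and> poly_apply A v p = 0"
proof -
  define f where "f k = ((*v) A ^^ k) v" for k
  let ?N = "DIM(complex^'n)"
  show ?thesis
  proof (cases "inj_on f {..?N}")
    case False
    then obtain k l where kl: "f k = f l" "k \<noteq> l"
      by (auto simp: inj_on_def)
    let ?p = "monom 1 k + monom (-1) l :: complex poly"
    have "coeff ?p k = 1" using kl(2) by simp
    then have "?p \<noteq> 0" by (metis coeff_0 zero_neq_one)
    moreover have "poly_apply A v ?p = 0"
      using kl(1) by (simp only: poly_apply_add poly_apply_monom f_def[symmetric]) simp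
    ultimately show ?thesis by blast
  next
    case True
    then have "card (f ` {..?N}) = Suc ?N"
      by (simp add: card_image)
    then have "dependent (f ` {..?N})"
      by (intro dependent_biggerset) auto
    then obtain u where u: "\<exists>w\<in>f ` {..?N}. u w \<noteq> 0" "(\<Sum>w\<in>f ` {..?N}. u w *\<^sub>R w) = 0"
      using dependent_finite[of "f ` {..?N}"] by auto
    then obtain k where k: "k \<le> ?N" "u (f k) \<noteq> 0" by auto
    let ?p = "\<Sum>l\<in>{..?N}. monom (complex_of_real (u (f l))) l"
    have "coeff ?p k = u (f k)"
      using k by (simp add: coeff_sum)
    then have "?p \<noteq> 0" using k by (metis coeff_0 of_real_eq_0_iff)
    moreover have "poly_apply A v ?p = (\<Sum>l\<in>{..?N}. u (f l) *\<^sub>R f l)"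
      by (simp add: poly_apply_sum poly_apply_monom f_def vec_eq_iff)
         (simp add: scaleR_conv_of_real)
    then have "poly_apply A v ?p = 0"
      using u(2) True by (simp add: sum.reindex)
    ultimately show ?thesis by blast
  qed
qed

text \<open>Split a root \<open>r\<close> off an annihilating polynomial, p = (x - r) q. Either q(A)
  v is an eigenvector for \<open>r\<close>, or \<open>q\<close> annihilates \<open>v\<close> and has
  smaller degree. All vectors p(A) v stay in \<open>V\<close>.\<close>

lemma invariant_subspace_eigenvector:
  fixes A :: "complex^'n^'n"
  assumes V: "vec.subspace V" "\<And>x. x \<in> V \<Longrightarrow> A *v x \<in> V" and v: "v \<in> V" "v \<noteq> 0"
  shows "\<exists>w c. w \<in> V \<and> w \<noteq> 0 \<and> A *v w = c *s w"
proof -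
  have in_V: "poly_apply A v q \<in> V" for q
    by (induction q) (auto simp: V v vec.subspace_0 vec.subspace_add vec.subspace_scale)
  have "\<exists>w c. w \<in> V \<and> w \<noteq> 0 \<and> A *v w = c *s w"
    if "p \<noteq> 0" "poly_apply A v p = 0" for p
    using that
  proof (induction "degree p" arbitrary: p)
    case 0
    then obtain a where "p = [:a:]" "a \<noteq> 0"
      by (metis degree_eq_zeroE pCons_0_0)
    then show ?case using 0 v by (simp add: vec.scale_eq_0_iff)
  next
    case (Suc d)
    then have "\<not> constant (poly p)"
      by (simp add: constant_degree)
    then obtain r where "poly p r = 0"
      using fundamental_theorem_of_algebra by blast
    then obtain q where q: "p = [:-r, 1:] * q"
      by (metis dvdE poly_eq_0_iff_dvd)
    have q0: "q \<noteq> 0" using Suc.prems q by auto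
    have "degree p = Suc (degree q)"
      unfolding q using q0 by (subst degree_mult_eq) auto
    then have deg: "d = degree q" using Suc.hyps(2) by simp
    have "p = smult (- r) q + pCons 0 q"
      unfolding q by simp
    then have "poly_apply A v p = - r *s poly_apply A v q + A *v poly_apply A v q"
      by (simp only: poly_apply_add poly_apply_smult poly_apply_pCons) simp
    then have *: "A *v poly_apply A v q = r *s poly_apply A v q"
      using Suc.prems(2) by (simp add: vec_eq_iff eq_neg_iff_add_eq_0)
    show ?case
    proof (cases "poly_apply A v q = 0")
      case True
      then show ?thesis using Suc.hyps(1)[OF deg q0] by simp
    next
      case False
      then show ?thesis using * in_V by blast
    qed
  qed
  then show ?thesis using annihilating_poly_exists[of A v] by blast
qed

subsection \<open>Unitary diagonalization\<close>

definition cinner :: "complex^'n \<Rightarrow> complex^'n \<Rightarrow> complex" where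
  "cinner x y = (\<Sum>i\<in>UNIV. cnj (x $ i) * y $ i)"

definition diag_matrix :: "('n \<Rightarrow> complex) \<Rightarrow> complex^'n^'n" where
  "diag_matrix u = (\<chi> i j. if i = j then u i else 0)"

lemma cinner_add_right: "cinner x (y + z) = cinner x y + cinner x z"
  by (simp add: cinner_def algebra_simps sum.distrib)

lemma cinner_smult_right: "cinner x (c *s y) = c * cinner x y"
  by (simp add: cinner_def sum_distrib_left algebra_simps)

lemma cinner_smult_left: "cinner (c *s x) y = cnj c * cinner x y"
  by (simp add: cinner_def sum_distrib_left algebra_simps)

lemma cinner_zero_right [simp]: "cinner x 0 = 0"
  by (simp add: cinner_def)

lemma cinner_commute: "cinner y x = cnj (cinner x y)"
  by (simp add: cinner_def mult.commute)

lemma cinner_self: "cinner x x = (\<Sum>i\<in>UNIV. (cmod (x $ i))\<^sup>2)"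
  unfolding cinner_def of_real_sum complex_norm_square by (simp add: mult.commute)

lemma cinner_self_eq_0: "cinner x x = 0 \<longleftrightarrow> x = 0"
proof -
  have "cinner x x = 0 \<longleftrightarrow> (\<Sum>i\<in>UNIV. (cmod (x $ i))\<^sup>2) = 0"
    by (simp only: cinner_self of_real_eq_0_iff)
  also have "\<dots> \<longleftrightarrow> x = 0"
    by (subst sum_nonneg_eq_0_iff) (auto simp: vec_eq_iff)
  finally show ?thesis .
qed

lemma unit_multiple_exists:
  assumes "x \<noteq> 0"
  shows "\<exists>c. c \<noteq> 0 \<and> cinner (c *s x) (c *s x) = 1"
proof -
  define r where "r = (\<Sum>i\<in>UNIV. (cmod (x $ i))\<^sup>2)"
  have r: "cinner x x = of_real r" by (simp add: r_def cinner_self)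
  have "r \<ge> 0" by (simp add: r_def sum_nonneg)
  moreover have "r \<noteq> 0" using assms cinner_self_eq_0[of x] r by auto
  ultimately have "r > 0" by simp
  let ?c = "complex_of_real (1 / sqrt r)"
  have "cinner (?c *s x) (?c *s x) = of_real (1 / sqrt r * (1 / sqrt r) * r)"
    by (simp only: cinner_smult_left cinner_smult_right r of_real_mult complex_cnj_complex_of_real mult.assoc)
  also have "1 / sqrt r * (1 / sqrt r) * r = 1"
    using \<open>r > 0\<close> by simp
  finally have "cinner (?c *s x) (?c *s x) = 1" by simp
  moreover have "?c \<noteq> 0" using \<open>r > 0\<close> by simp
  ultimately show ?thesis by blast
qed

lemma cinner_adjoint: "cinner (adjoint_matrix A *v x) y = cinner x (A *v y)"
proof -
  have "cinner (adjoint_matrix A *v x) y = (\<Sum>i\<in>UNIV. \<Sum>j\<in>UNIV. A $ j $ i * cnj (x $ j) * y $ i)"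
    by (simp add: cinner_def adjoint_matrix_def matrix_vector_mult_def sum_distrib_right)
  also have "\<dots> = (\<Sum>j\<in>UNIV. \<Sum>i\<in>UNIV. A $ j $ i * cnj (x $ j) * y $ i)"
    by (rule sum.swap)
  also have "\<dots> = cinner x (A *v y)"
    by (simp add: cinner_def matrix_vector_mult_def sum_distrib_left algebra_simps)
  finally show ?thesis .
qed

definition normal_matrix :: "complex^'n^'n \<Rightarrow> bool" where
  "normal_matrix A \<longleftrightarrow> A ** adjoint_matrix A = adjoint_matrix A ** A"

text \<open>The defect \<open>y\<close> is orthogonal to \<open>x\<close>, and it is again a
  \<open>c\<close>-eigenvector because \<open>A\<close> commutes with its adjoint. Together these
  make \<open>y\<close> orthogonal to itself.\<close>

lemma normal_eigenvector_adjoint: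
  assumes "normal_matrix A" "A *v x = c *s x"
  shows "adjoint_matrix A *v x = cnj c *s x"
proof -
  let ?B = "adjoint_matrix A"
  define y where "y = ?B *v x - cnj c *s x"
  have comm: "?B *v (A *v x) = A *v (?B *v x)"
    using assms(1) by (simp add: matrix_vector_mul_assoc normal_matrix_def)
  have 2: "cinner x y = 0"
  proof -
    have "cinner y x = cinner (?B *v x) x - c * cinner x x"
      by (simp add: y_def cinner_def algebra_simps sum_subtractf sum_distrib_left)
    also have "\<dots> = 0" by (simp add: cinner_adjoint assms(2) cinner_smult_right)
    finally show ?thesis using cinner_commute[of x y] by simp
  qed
  have 1: "cinner (?B *v x) y = 0"
  proof -
    have "A *v y = c *s y"
      using comm by (simp add: y_def assms(2) algebra_simps matrix_vector_mult_smult
          vec.scale_right_diff_distrib mult.commute)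
    then show ?thesis using 2 by (simp add: cinner_adjoint cinner_smult_right)
  qed
  have "cinner y y = cinner (?B *v x) y - c * cinner x y"
    by (subst y_def) (simp add: cinner_def algebra_simps sum_subtractf sum_distrib_left)
  then have "y = 0" using 1 2 by (simp add: cinner_self_eq_0)
  then show ?thesis by (simp add: y_def)
qed

text \<open>The index \<open>k\<close> outside \<open>I\<close> supplies a zero row, so the square
  matrix of the conditions is singular and has a kernel vector.\<close>

lemma orthogonal_vector_exists:
  fixes f :: "'n \<Rightarrow> complex^'n"
  assumes "k \<notin> I"
  shows "\<exists>x. x \<noteq> 0 \<and> (\<forall>i\<in>I. cinner (f i) x = 0)"
proof -
  define M :: "complex^'n^'n" where "M = (\<chi> i j. if i \<in> I then cnj (f i $ j) else 0)"
  have "row k M = 0" using assms by (simp add: row_def M_def vec_eq_iff)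
  then have "det M = 0" by (rule det_zero_row)
  then have "\<not> invertible M" by (simp add: invertible_det_nz)
  then have "\<not> (\<exists>B. B ** M = mat 1)"
    using invertible_left_inverse by blast
  then obtain x where x: "M *v x = 0" "x \<noteq> 0"
    by (auto simp: matrix_left_invertible_ker)
  have "cinner (f i) x = (M *v x) $ i" if "i \<in> I" for i
    using that by (simp add: cinner_def M_def matrix_vector_mult_def)
  then show ?thesis using x by auto
qed

text \<open>The eigenvectors found so far are also eigenvectors of the adjoint, so their orthogonal
  complement is invariant under \<open>A\<close> and contains a further eigenvector. Growing a
  subset \<open>I\<close> of the index type makes the final basis indexed by the matrix
  indices.\<close>

lemma orthonormal_eigenvectors_exist:
  fixes A :: "complex^'n^'n" and I :: "'n set"
  assumes A: "normal_matrix A" and "finite I"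
  shows "\<exists>f u. (\<forall>i\<in>I. A *v f i = u i *s f i) \<and>
               (\<forall>i\<in>I. \<forall>j\<in>I. cinner (f i) (f j) = (if i = j then 1 else 0))"
  using \<open>finite I\<close>
proof induction
  case (insert k I)
  then obtain f u where f: "\<And>i. i \<in> I \<Longrightarrow> A *v f i = u i *s f i"
    "\<And>i j. i \<in> I \<Longrightarrow> j \<in> I \<Longrightarrow> cinner (f i) (f j) = (if i = j then 1 else 0)"
    by metis
  define V where "V = {x. \<forall>i\<in>I. cinner (f i) x = 0}"
  have V: "vec.subspace V"
    by (auto simp: V_def vec.subspace_def cinner_add_right cinner_smult_right)
  have inv: "A *v x \<in> V" if "x \<in> V" for x
    using that normal_eigenvector_adjoint[OF A f(1)]
    by (auto simp: V_def cinner_smult_left simp flip: cinner_adjoint)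
  obtain x where "x \<in> V" "x \<noteq> 0"
    using orthogonal_vector_exists[OF insert.hyps(2)] by (auto simp: V_def)
  then obtain w c where w: "w \<in> V" "w \<noteq> 0" "A *v w = c *s w"
    using invariant_subspace_eigenvector[OF V inv] by blast
  obtain a where a: "cinner (a *s w) (a *s w) = 1"
    using unit_multiple_exists[OF w(2)] by blast
  have aw: "cinner (f i) (a *s w) = 0" "cinner (a *s w) (f i) = 0" if "i \<in> I" for i
    using w(1) that cinner_commute[of "a *s w" "f i"] by (auto simp: V_def cinner_smult_right)
  have Aaw: "A *v (a *s w) = c *s (a *s w)"
    using w(3) by (simp add: matrix_vector_mult_smult mult.commute)
  let ?f = "f(k := a *s w)" and ?u = "u(k := c)"
  have "A *v ?f i = ?u i *s ?f i" if "i \<in> insert k I" for i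
  proof (cases "i = k")
    case True
    then show ?thesis using Aaw by (simp del: vector_smult_assoc vec.scale_scale)
  next
    case False
    then show ?thesis using that f(1) by simp
  qed
  moreover have "cinner (?f i) (?f j) = (if i = j then 1 else 0)"
    if "i \<in> insert k I" "j \<in> insert k I" for i j
  proof (cases "i = k"; cases "j = k")
    assume "i = k" "j = k" then show ?thesis using a by simp
  next
    assume "i = k" "j \<noteq> k" then show ?thesis using aw(2)[of j] that by simp
  next
    assume "i \<noteq> k" "j = k" then show ?thesis using aw(1)[of i] that by simp
  next
    assume "i \<noteq> k" "j \<noteq> k" then show ?thesis using f(2)[of i j] that by simp
  qed
  ultimately show ?case by blast
qed auto

lemma diag_matrix_mult_left: "(diag_matrix u ** A) $ i $ j = u i * A $ i $ j"
  by (simp add: diag_matrix_def matrix_matrix_mult_def if_distribR if_distrib cong: if_cong)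

lemma diag_matrix_mult_right: "(A ** diag_matrix u) $ i $ j = A $ i $ j * u j"
  by (simp add: diag_matrix_def matrix_matrix_mult_def if_distribR if_distrib cong: if_cong)

lemma unitary_matrixI:
  assumes "adjoint_matrix A ** A = mat 1" shows "unitary_matrix A"
  using assms matrix_left_right_inverse[of "adjoint_matrix A" A] by (simp add: unitary_matrix_def)

theorem normal_matrix_diagonalization:
  fixes A :: "complex^'n^'n"
  assumes "normal_matrix A"
  shows "\<exists>U u. unitary_matrix U \<and> A = U ** diag_matrix u ** adjoint_matrix U"
proof -
  obtain f :: "'n \<Rightarrow> complex^'n" and u where "\<forall>i\<in>UNIV. A *v f i = u i *s f i"
    "\<forall>i\<in>UNIV. \<forall>j\<in>UNIV. cinner (f i) (f j) = (if i = j then 1 else 0)"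
    using orthonormal_eigenvectors_exist[OF assms finite[of UNIV]] by blast
  then have f: "\<And>i. A *v f i = u i *s f i"
    "\<And>i j. cinner (f i) (f j) = (if i = j then 1 else 0)"
    by auto
  define U :: "complex^'n^'n" where "U = (\<chi> i j. f j $ i)"
  have "adjoint_matrix U ** U = mat 1"
    using f(2) by (simp add: vec_eq_iff adjoint_matrix_def U_def matrix_matrix_mult_def mat_def
        cinner_def)
  then have U: "unitary_matrix U" by (rule unitary_matrixI)
  have "A ** U = U ** diag_matrix u"
  proof (simp add: vec_eq_iff diag_matrix_mult_right, intro allI)
    fix i j
    have "(A ** U) $ i $ j = (A *v f j) $ i"
      by (simp add: U_def matrix_matrix_mult_def matrix_vector_mult_def)
    then show "(A ** U) $ i $ j = U $ i $ j * u j"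
      by (simp add: f(1) U_def mult.commute)
  qed
  then have "A ** (U ** adjoint_matrix U) = U ** diag_matrix u ** adjoint_matrix U"
    by (simp add: matrix_mul_assoc)
  then show ?thesis using U by (auto simp: unitary_matrix_def)
qed

subsection \<open>The special unitary group and its diagonal torus\<close>

abbreviation SU :: "(complex^'n^'n) set" where
  "SU \<equiv> carrier special_unitary_group"

definition torus :: "('n::finite \<Rightarrow> complex) set" where
  "torus = {u. (\<forall>i. cmod (u i) = 1) \<and> (\<Prod>i\<in>UNIV. u i) = 1}"

lemma SU_iff: "A \<in> SU \<longleftrightarrow> unitary_matrix A \<and> det A = 1"
  by (simp add: special_unitary_group_def)

lemma mult_SU [simp]: "A \<otimes>\<^bsub>special_unitary_group\<^esub> B = A ** B"
  by (simp add: special_unitary_group_def)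

lemma one_SU [simp]: "\<one>\<^bsub>special_unitary_group\<^esub> = mat 1"
  by (simp add: special_unitary_group_def)

lemma cmod_1_iff: "cmod z = 1 \<longleftrightarrow> cnj z * z = 1"
  by (metis complex_norm_square mult.commute norm_ge_zero of_real_1 of_real_eq_iff power2_eq_1_iff
      of_real_power norm_one one_power2 power_one real_sqrt_unique)

lemma det_adjoint_matrix: "det (adjoint_matrix A) = cnj (det A)" for A :: "complex^'n^'n"
proof -
  define B :: "complex^'n^'n" where "B = (\<chi> i j. cnj (A $ i $ j))"
  have "adjoint_matrix A = transpose B"
    by (simp add: adjoint_matrix_def B_def transpose_def)
  then have "det (adjoint_matrix A) = det B" by simp
  also have "\<dots> = cnj (det A)" by (simp add: det_def B_def)
  finally show ?thesis .
qed

lemma cmod_det_unitary: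
  assumes "unitary_matrix A" shows "cmod (det A) = 1"
proof -
  have "det (adjoint_matrix A ** A) = 1" using assms by (simp add: unitary_matrix_def)
  then show ?thesis by (simp add: det_mul det_adjoint_matrix cmod_1_iff)
qed

lemma SU_mult: "A \<in> SU \<Longrightarrow> B \<in> SU \<Longrightarrow> A ** B \<in> SU"
  by (simp add: SU_iff unitary_matrix_mult det_mul)

lemma SU_one: "mat 1 \<in> SU"
  by (simp add: SU_iff unitary_matrix_def)

lemma SU_adjoint: "A \<in> SU \<Longrightarrow> adjoint_matrix A \<in> SU"
  by (simp add: SU_iff unitary_matrix_adjoint det_adjoint_matrix)

lemma SU_adjoint_mult: "A \<in> SU \<Longrightarrow> adjoint_matrix A ** A = mat 1"
  by (simp add: SU_iff unitary_matrix_def)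

lemma SU_mult_adjoint: "A \<in> SU \<Longrightarrow> A ** adjoint_matrix A = mat 1"
  by (simp add: SU_iff unitary_matrix_def)

lemma diag_matrix_mult: "diag_matrix u ** diag_matrix v = diag_matrix (\<lambda>i. u i * v i)"
  by (simp add: vec_eq_iff diag_matrix_mult_left) (simp add: diag_matrix_def)

lemma diag_matrix_one: "diag_matrix (\<lambda>i. 1) = mat 1"
  by (simp add: vec_eq_iff diag_matrix_def mat_def)

lemma adjoint_diag_matrix: "adjoint_matrix (diag_matrix u) = diag_matrix (\<lambda>i. cnj (u i))"
  by (simp add: vec_eq_iff diag_matrix_def adjoint_matrix_def)

lemma diag_matrix_eq_iff [simp]: "diag_matrix u = diag_matrix v \<longleftrightarrow> u = v"
  by (auto simp: vec_eq_iff diag_matrix_def fun_eq_iff split: if_splits)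

lemma det_diag_matrix: "det (diag_matrix u) = (\<Prod>i\<in>UNIV. u i)"
  by (subst det_diagonal) (simp_all add: diag_matrix_def)

lemma unitary_diag_matrix: "unitary_matrix (diag_matrix u) \<longleftrightarrow> (\<forall>i. cmod (u i) = 1)"
  by (simp add: unitary_matrix_def adjoint_diag_matrix diag_matrix_mult mult.commute cmod_1_iff
      flip: diag_matrix_one) (simp add: fun_eq_iff mult.commute)

lemma diag_matrix_in_SU: "diag_matrix u \<in> SU \<longleftrightarrow> u \<in> torus"
  by (simp add: SU_iff unitary_diag_matrix det_diag_matrix torus_def)

lemma diagonal_iff_commute_regular:
  assumes "inj u"
  shows "A ** diag_matrix u = diag_matrix u ** A \<longleftrightarrow> (\<exists>v. A = diag_matrix v)"
proof
  assume *: "A ** diag_matrix u = diag_matrix u ** A"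
  have "A $ i $ j = 0" if "i \<noteq> j" for i j
  proof -
    have "A $ i $ j * u j = u i * A $ i $ j"
      using * by (metis diag_matrix_mult_left diag_matrix_mult_right)
    then show ?thesis using that assms by (auto simp: inj_def mult.commute)
  qed
  then have "A = diag_matrix (\<lambda>i. A $ i $ i)"
    by (auto simp: vec_eq_iff diag_matrix_def)
  then show "\<exists>v. A = diag_matrix v" by blast
qed (auto simp: diag_matrix_mult mult.commute)

lemma normal_unitary: "unitary_matrix A \<Longrightarrow> normal_matrix A"
  by (simp add: unitary_matrix_def normal_matrix_def)

text \<open>A diagonal phase on the right of \<open>U\<close> corrects its determinant and cancels
  in the conjugation, since diagonal matrices commute.\<close>

lemma normal_diagonalization_SU:
  fixes A :: "complex^'n^'n"
  assumes "normal_matrix A"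
  shows "\<exists>U\<in>SU. \<exists>u. A = U ** diag_matrix u ** adjoint_matrix U"
proof -
  obtain U u where U: "unitary_matrix U" and A: "A = U ** diag_matrix u ** adjoint_matrix U"
    using normal_matrix_diagonalization[OF assms] by blast
  obtain k :: 'n where True by simp
  define d where "d = (\<lambda>i. if i = k then cnj (det U) else 1)"
  have cd: "cmod (d i) = 1" for i
    using cmod_det_unitary[OF U] by (simp add: d_def)
  let ?V = "U ** diag_matrix d"
  have "unitary_matrix ?V"
    using U cd by (simp add: unitary_matrix_mult unitary_diag_matrix)
  moreover have "det ?V = 1"
    using cmod_det_unitary[OF U]
    by (simp add: det_mul det_diag_matrix d_def cmod_1_iff mult.commute)
  moreover have "?V ** diag_matrix u ** adjoint_matrix ?V = A"
  proof -
    have "diag_matrix d ** diag_matrix u ** diag_matrix (\<lambda>i. cnj (d i)) = diag_matrix u"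
      using cd by (simp add: diag_matrix_mult cmod_1_iff fun_eq_iff algebra_simps)
    then show ?thesis
      by (simp add: A adjoint_matrix_mult adjoint_diag_matrix) (metis matrix_mul_assoc)
  qed
  ultimately show ?thesis
    by (intro bexI[of _ ?V] exI[of _ u]) (simp_all add: SU_iff)
qed

lemma SU_diagonalization:
  assumes "A \<in> SU"
  shows "\<exists>U\<in>SU. \<exists>u\<in>torus. A = U ** diag_matrix u ** adjoint_matrix U"
proof -
  obtain U u where U: "U \<in> SU" "A = U ** diag_matrix u ** adjoint_matrix U"
    using normal_diagonalization_SU assms normal_unitary by (metis SU_iff)
  then have "adjoint_matrix U ** A ** U = diag_matrix u"
    using SU_adjoint_mult[OF U(1)] by (metis matrix_mul_assoc matrix_mul_lid matrix_mul_rid)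
  then have "diag_matrix u \<in> SU"
    using assms U(1) by (metis SU_adjoint SU_mult)
  then show ?thesis using U diag_matrix_in_SU by blast
qed

text \<open>Links the Euclidean structure of the type with traces, so that statements about real
  parts of traces become statements about isometries.\<close>

lemma inner_matrix: "A \<bullet> B = Re (trace (A ** adjoint_matrix B))" for A B :: "complex^'n^'n"
  by (simp add: inner_vec_def trace_def matrix_matrix_mult_def adjoint_matrix_def inner_complex_def)

lemma trace_conj_SU: "U \<in> SU \<Longrightarrow> trace (U ** A ** adjoint_matrix U) = trace A"
  by (metis SU_adjoint_mult matrix_mul_assoc matrix_mul_rid trace_mul_sym)

lemma trace_diag_matrix: "trace (diag_matrix u) = (\<Sum>i\<in>UNIV. u i)"
  by (simp add: trace_def diag_matrix_def)

lemma norm_SU_mult_left: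
  fixes U A :: "complex^'n^'n"
  assumes "U \<in> SU" shows "norm (U ** A) = norm A"
proof -
  have "trace (U ** A ** adjoint_matrix (U ** A)) = trace (A ** adjoint_matrix A)"
    using trace_conj_SU[OF assms, of "A ** adjoint_matrix A"]
    by (simp add: adjoint_matrix_mult matrix_mul_assoc)
  then show ?thesis by (simp add: norm_eq_sqrt_inner inner_matrix)
qed

lemma norm_SU_mult_right:
  fixes U A :: "complex^'n^'n"
  assumes "U \<in> SU" shows "norm (A ** U) = norm A"
proof -
  have "A ** U ** adjoint_matrix (A ** U) = A ** (U ** adjoint_matrix U) ** adjoint_matrix A"
    by (simp add: adjoint_matrix_mult matrix_mul_assoc)
  then show ?thesis using SU_mult_adjoint[OF assms] by (simp add: norm_eq_sqrt_inner inner_matrix)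
qed

subsection \<open>Quaternion blocks\<close>

text \<open>The quaternion matrix with first column (a, b) and second column (- cnj b, cnj a),
  placed in the coordinates \<open>i\<close>, \<open>j\<close> of an identity matrix. Unit
  quaternions give the embedded copies of SU_2 that serve as noncommuting test elements.\<close>

definition quaternion_block :: "'n \<Rightarrow> 'n \<Rightarrow> complex \<Rightarrow> complex \<Rightarrow> complex^'n^'n" where
  "quaternion_block i j a b = (\<chi> k l.
     if k = i then (if l = i then a else if l = j then - cnj b else 0)
     else if k = j then (if l = i then b else if l = j then cnj a else 0)
     else if k = l then 1 else 0)"

lemma sum_split_two:
  fixes f :: "'n::finite \<Rightarrow> 'a::comm_monoid_add"
  assumes "i \<noteq> j"
  shows "sum f UNIV = f i + f j + sum f (UNIV - {i, j})"
  using assms by (subst sum.subset_diff[of "{i, j}"]) (auto simp: add.commute)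

lemma quaternion_block_mult:
  fixes i j :: "'n::finite"
  assumes ij: "i \<noteq> j"
  shows "quaternion_block i j a b ** quaternion_block i j c d =
    quaternion_block i j (a * c - cnj b * d) (b * c + cnj a * d)"
proof -
  have "(\<Sum>m\<in>UNIV. quaternion_block i j a b $ k $ m * quaternion_block i j c d $ m $ l) =
     quaternion_block i j (a * c - cnj b * d) (b * c + cnj a * d) $ k $ l" for k l
  proof -
    consider "k = i" | "k = j" | "k \<noteq> i" "k \<noteq> j" by blast
    then show ?thesis
    proof cases
      case 3
      have "(\<Sum>m\<in>UNIV. quaternion_block i j a b $ k $ m * quaternion_block i j c d $ m $ l)
        = (\<Sum>m\<in>UNIV. if m = k then quaternion_block i j c d $ k $ l else 0)"
        using 3 by (intro sum.cong) (auto simp: quaternion_block_def)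
      then show ?thesis using 3 by (simp add: quaternion_block_def)
    qed (use ij in \<open>auto simp: sum_split_two[OF ij] quaternion_block_def algebra_simps\<close>)
  qed
  then show ?thesis by (simp add: matrix_matrix_mult_def vec_eq_iff)
qed

lemma adjoint_quaternion_block:
  "i \<noteq> j \<Longrightarrow> adjoint_matrix (quaternion_block i j a b) = quaternion_block i j (cnj a) (- b)"
  by (auto simp: adjoint_matrix_def quaternion_block_def vec_eq_iff)

lemma quaternion_block_one: "i \<noteq> j \<Longrightarrow> quaternion_block i j 1 0 = mat 1"
  by (auto simp: quaternion_block_def vec_eq_iff mat_def)

text \<open>In the Leibniz sum a nonzero product forces the permutation to fix every index other
  than \<open>i\<close>, \<open>j\<close>, which leaves the identity and one transposition.\<close>

lemma det_quaternion_block: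
  fixes i j :: "'n::finite"
  assumes ij: "i \<noteq> j"
  shows "det (quaternion_block i j a b) = a * cnj a + b * cnj b"
proof -
  let ?B = "quaternion_block i j a b" and ?t = "Transposition.transpose i j"
  let ?f = "\<lambda>p. of_int (sign p) * (\<Prod>k\<in>UNIV. ?B $ k $ p k)"
  have t: "?t \<noteq> id" using ij by (metis id_apply transpose_apply_first)
  have zero: "?f p = 0" if "p permutes UNIV" "p \<noteq> id" "p \<noteq> ?t" for p
  proof (rule ccontr)
    assume "?f p \<noteq> 0"
    then have nz: "?B $ k $ p k \<noteq> 0" for k
      by (simp add: prod_zero_iff)
    have fix_rest: "p k = k" if "k \<noteq> i" "k \<noteq> j" for k
      using nz[of k] that by (auto simp: quaternion_block_def split: if_splits)
    have inj: "inj p" using that(1) by (rule permutes_inj)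
    have "p i \<in> {i, j}" "p j \<in> {i, j}"
      using nz[of i] nz[of j] ij by (auto simp: quaternion_block_def split: if_splits)
    moreover have "p i \<noteq> p j" using inj ij by (auto dest: injD)
    ultimately have "(p i = i \<and> p j = j) \<or> (p i = j \<and> p j = i)" by auto
    then have "p = id \<or> p = ?t"
      using fix_rest by (auto simp: fun_eq_iff Transposition.transpose_def) metis+
    then show False using that by simp
  qed
  have rest: "(\<Prod>k\<in>UNIV - {i, j}. ?B $ k $ k) = 1" "(\<Prod>k\<in>UNIV - {i, j}. ?B $ k $ ?t k) = 1"
    by (intro prod.neutral; auto simp: quaternion_block_def)+
  have prod2: "prod g UNIV = g i * g j * prod g (UNIV - {i, j})" for g :: "'n \<Rightarrow> complex"
    using ij by (subst prod.subset_diff[of "{i, j}"]) (auto simp: mult.commute)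
  have "det ?B = sum ?f {p. p permutes UNIV}" by (simp add: det_def)
  also have "\<dots> = sum ?f {id, ?t}"
    by (rule sum.mono_neutral_right) (auto simp: permutes_id permutes_swap_id zero)
  also have "\<dots> = ?f id + ?f ?t" using t by simp
  also have "\<dots> = a * cnj a + b * cnj b"
    unfolding prod2 using ij rest
    by (simp add: sign_swap_id sign_id) (simp add: quaternion_block_def)
  finally show ?thesis .
qed

lemma quaternion_block_SU:
  assumes "i \<noteq> j" "a * cnj a + b * cnj b = 1"
  shows "quaternion_block i j a b \<in> SU"
proof -
  have "adjoint_matrix (quaternion_block i j a b) ** quaternion_block i j a b = mat 1"
    using assms by (simp add: adjoint_quaternion_block quaternion_block_mult
        mult.commute flip: quaternion_block_one)
  then show ?thesis using assms by (simp add: SU_iff unitary_matrixI det_quaternion_block)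
qed

subsection \<open>Automorphisms normalizing the torus\<close>

lemma exists_complex_unit_root:
  assumes "cmod z = 1" "0 < n"
  shows "\<exists>w. cmod w = 1 \<and> w ^ n = z"
proof -
  obtain w where w: "z = w ^ n" using exists_complex_root assms(2) by blast
  then have "cmod w ^ n = 1 ^ n" using assms(1) by (simp add: norm_power)
  then have "cmod w = 1" using assms(2) by (metis norm_ge_zero power_eq_imp_eq_base zero_le_one)
  with w show ?thesis by blast
qed

text \<open>A common factor multiplies the product by its \<open>CARD('n)\<close>-th power, so a
  root of the inverse product works. Ratios and coincidences of entries are unaffected, and these
  are all that the later constructions prescribe.\<close>

lemma torus_scaling_exists:
  fixes u :: "'n::finite \<Rightarrow> complex"
  assumes "\<And>i. cmod (u i) = 1"
  shows "\<exists>k. cmod k = 1 \<and> (\<lambda>i. k * u i) \<in> torus"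
proof -
  have "cmod (cnj (\<Prod>i\<in>UNIV. u i)) = 1"
    using assms by (simp add: prod_norm[symmetric] del: cnj_prod)
  then obtain k where k: "cmod k = 1" "k ^ CARD('n) = cnj (\<Prod>i\<in>UNIV. u i)"
    using exists_complex_unit_root[of _ "CARD('n)"] by (metis zero_less_card_finite)
  have "cmod (\<Prod>i\<in>UNIV. u i) = 1" using assms by (simp add: prod_norm[symmetric])
  then have "(\<Prod>i\<in>UNIV. k * u i) = 1"
    using k(2) by (simp add: prod.distrib cmod_1_iff del: cnj_prod)
  then show ?thesis using k assms by (auto simp: torus_def norm_mult)
qed

lemma torus_with_partition_exists:
  fixes c :: "'n::finite \<Rightarrow> nat"
  shows "\<exists>u\<in>torus. \<forall>i j. u i = u j \<longleftrightarrow> c i = c j"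
proof -
  \<comment> \<open>An injective function of \<open>c i\<close> with values in [0, pi], where the
    cosine alone separates angles.\<close>
  define t where "t i = 1 / (1 + real (c i))" for i
  have t: "0 \<le> t i" "t i \<le> pi" for i
    using pi_gt3 by (auto simp: t_def intro: order_trans[of _ 1])
  obtain k where k: "cmod k = 1" "(\<lambda>i. k * cis (t i)) \<in> torus"
    using torus_scaling_exists[of "\<lambda>i. cis (t i)"] by auto
  have "k * cis (t i) = k * cis (t j) \<longleftrightarrow> c i = c j" for i j
  proof -
    have "k \<noteq> 0" using k(1) by auto
    moreover have "cis (t i) = cis (t j) \<longleftrightarrow> t i = t j"
      using cos_inj_pi[OF t[of i] t[of j]] by (metis cis.simps(1))
    ultimately show ?thesis by (simp add: t_def)
  qed
  with k show ?thesis by (intro bexI[of _ "\<lambda>i. k * cis (t i)"]) auto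
qed

lemma torus_regular_exists: "\<exists>u\<in>torus. inj (u :: 'n::finite \<Rightarrow> complex)"
proof -
  obtain c :: "'n \<Rightarrow> nat" where "inj c"
    using finite_imp_inj_to_nat_seg[of "UNIV :: 'n set"] by auto
  then show ?thesis
    using torus_with_partition_exists[of c] unfolding inj_def by metis
qed

lemma torus_cmod: "u \<in> torus \<Longrightarrow> cmod (u i) = 1"
  by (simp add: torus_def)

lemma torus_nz: "u \<in> torus \<Longrightarrow> u i \<noteq> 0"
  using torus_cmod[of u i] by auto

lemma torus_mult: "u \<in> torus \<Longrightarrow> v \<in> torus \<Longrightarrow> (\<lambda>i. u i * v i) \<in> torus"
  by (simp add: torus_def norm_mult prod.distrib)

lemma torus_divide: "u \<in> torus \<Longrightarrow> v \<in> torus \<Longrightarrow> (\<lambda>i. u i / v i) \<in> torus"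
  by (simp add: torus_def norm_divide prod_dividef)

lemma torus_one: "(\<lambda>i. 1) \<in> torus"
  by (simp add: torus_def)

lemma quaternion_block_commute_diag:
  assumes "u i = u j"
  shows "quaternion_block i j a b ** diag_matrix u = diag_matrix u ** quaternion_block i j a b"
proof -
  have "quaternion_block i j a b $ k $ l = 0 \<or> u k = u l" for k l
  proof (cases "k = l")
    case False
    show ?thesis
    proof (rule disjCI)
      assume "u k \<noteq> u l"
      then have "{k, l} \<noteq> {i, j}" using assms by (metis doubleton_eq_iff)
      then show "quaternion_block i j a b $ k $ l = 0" using False
        unfolding quaternion_block_def vec_lambda_beta by (simp split: if_split) auto
    qed
  qed simp
  then have "quaternion_block i j a b $ k $ l * u l = u k * quaternion_block i j a b $ k $ l" for k l
    by (metis mult.commute mult_zero_left)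
  then show ?thesis
    by (simp add: vec_eq_iff diag_matrix_mult_left diag_matrix_mult_right)
qed

text \<open>The right-hand side says that \<open>v\<close> lies in the double centralizer of \<open>u\<close>, hence is visible to
  abstract automorphisms.\<close>

lemma coarser_iff_double_centralizer:
  fixes u v :: "'n::finite \<Rightarrow> complex"
  shows "(\<forall>i j. u i = u j \<longrightarrow> v i = v j) \<longleftrightarrow>
    (\<forall>A\<in>SU. A ** diag_matrix u = diag_matrix u ** A \<longrightarrow> A ** diag_matrix v = diag_matrix v ** A)"
proof (intro iffI ballI impI allI)
  fix A :: "complex^'n^'n"
  assume uv: "\<forall>i j. u i = u j \<longrightarrow> v i = v j" and A: "A ** diag_matrix u = diag_matrix u ** A"
  show "A ** diag_matrix v = diag_matrix v ** A"
    unfolding vec_eq_iff diag_matrix_mult_left diag_matrix_mult_right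
  proof (intro allI)
    fix i j
    have "A $ i $ j * u j = u i * A $ i $ j"
      using A by (metis diag_matrix_mult_left diag_matrix_mult_right)
    then have "A $ i $ j = 0 \<or> u i = u j" by auto
    then have "A $ i $ j = 0 \<or> v i = v j" using uv by blast
    then show "A $ i $ j * v j = v i * A $ i $ j" by (elim disjE) (simp_all add: mult.commute)
  qed
next
  fix i j
  assume *: "\<forall>A\<in>SU. A ** diag_matrix u = diag_matrix u ** A \<longrightarrow>
    A ** diag_matrix v = diag_matrix v ** A" and u: "u i = u j"
  show "v i = v j"
  proof (cases "i = j")
    case False
    let ?A = "quaternion_block i j 0 1"
    have "?A \<in> SU" using quaternion_block_SU[OF False, of 0 1] by simp
    then have "?A ** diag_matrix v = diag_matrix v ** ?A"
      using *[rule_format, of ?A] quaternion_block_commute_diag[OF u] by blast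
    then have "?A $ j $ i * v i = v j * ?A $ j $ i"
      by (metis diag_matrix_mult_left diag_matrix_mult_right)
    then show ?thesis using False by (simp add: quaternion_block_def)
  qed simp
qed

section \<open>Elementary properties of an abstract automorphism\<close>

locale SU_automorphism =
  fixes \<psi> :: "complex^'n^'n \<Rightarrow> complex^'n^'n"
  assumes iso: "\<psi> \<in> iso special_unitary_group special_unitary_group"
begin

lemma closed: "A \<in> SU \<Longrightarrow> \<psi> A \<in> SU"
  using iso by (auto simp: iso_def hom_def)

lemma mult: "A \<in> SU \<Longrightarrow> B \<in> SU \<Longrightarrow> \<psi> (A ** B) = \<psi> A ** \<psi> B"
  using iso by (auto simp: iso_def hom_def)

lemma eq_iff: "A \<in> SU \<Longrightarrow> B \<in> SU \<Longrightarrow> \<psi> A = \<psi> B \<longleftrightarrow> A = B"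
  using iso by (auto simp: iso_def bij_betw_def inj_on_def)

lemma surj: "B \<in> SU \<Longrightarrow> \<exists>A\<in>SU. \<psi> A = B"
  using iso by (force simp: iso_def bij_betw_def)

lemma one: "\<psi> (mat 1) = mat 1"
proof -
  have "\<psi> (mat 1) ** \<psi> (mat 1) = \<psi> (mat 1)"
    using mult[OF SU_one SU_one] by simp
  then show ?thesis
    using SU_adjoint_mult[OF closed[OF SU_one]] by (metis matrix_mul_assoc matrix_mul_lid)
qed

lemma adjoint:
  assumes "A \<in> SU" shows "\<psi> (adjoint_matrix A) = adjoint_matrix (\<psi> A)"
proof -
  have "\<psi> (adjoint_matrix A) ** \<psi> A = mat 1"
    using mult[OF SU_adjoint[OF assms] assms] one SU_adjoint_mult[OF assms] by simp
  then show ?thesis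
    using SU_mult_adjoint[OF closed[OF assms]]
    by (metis matrix_mul_assoc matrix_mul_lid matrix_mul_rid)
qed

lemma commute_iff:
  "A \<in> SU \<Longrightarrow> B \<in> SU \<Longrightarrow> \<psi> A ** \<psi> B = \<psi> B ** \<psi> A \<longleftrightarrow> A ** B = B ** A"
  by (metis mult eq_iff SU_mult)

end

lemma conj_SU_iso:
  fixes U :: "complex^'n^'n"
  assumes U: "U \<in> SU"
  shows "(\<lambda>A. adjoint_matrix U ** A ** U) \<in> iso special_unitary_group special_unitary_group"
proof -
  note UU = SU_adjoint_mult[OF U] SU_mult_adjoint[OF U]
  have 1: "adjoint_matrix U ** A ** U \<in> SU" "U ** A ** adjoint_matrix U \<in> SU" if "A \<in> SU" for A
    using that U by (simp_all add: SU_mult SU_adjoint)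
  have 2: "adjoint_matrix U ** (U ** A ** adjoint_matrix U) ** U = A"
    "U ** (adjoint_matrix U ** A ** U) ** adjoint_matrix U = A" for A
  proof -
    have "adjoint_matrix U ** (U ** A ** adjoint_matrix U) ** U
        = (adjoint_matrix U ** U) ** A ** (adjoint_matrix U ** U)"
      "U ** (adjoint_matrix U ** A ** U) ** adjoint_matrix U
        = (U ** adjoint_matrix U) ** A ** (U ** adjoint_matrix U)"
      by (simp_all only: matrix_mul_assoc)
    then show "adjoint_matrix U ** (U ** A ** adjoint_matrix U) ** U = A"
      "U ** (adjoint_matrix U ** A ** U) ** adjoint_matrix U = A"
      by (simp_all add: UU)
  qed
  have 3: "adjoint_matrix U ** (A ** B) ** U = adjoint_matrix U ** A ** U ** (adjoint_matrix U ** B ** U)"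
    for A B
  proof -
    have "adjoint_matrix U ** A ** U ** (adjoint_matrix U ** B ** U)
        = adjoint_matrix U ** A ** (U ** adjoint_matrix U) ** B ** U"
      by (simp only: matrix_mul_assoc)
    then show ?thesis by (simp add: UU matrix_mul_assoc)
  qed
  have "bij_betw (\<lambda>A. adjoint_matrix U ** A ** U) SU SU"
    by (rule bij_betw_byWitness[where f' = "\<lambda>A. U ** A ** adjoint_matrix U"])
       (use 1 2 in auto)
  then show ?thesis using 1 3 by (auto simp: iso_def hom_def)
qed

section \<open>Conjugating an automorphism so that it preserves the diagonal torus\<close>

definition diagonal_matrix :: "complex^'n^'n \<Rightarrow> bool" where
  "diagonal_matrix A \<longleftrightarrow> (\<exists>u. A = diag_matrix u)"

locale SU_torus_automorphism = SU_automorphism \<psi>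
  for \<psi> :: "complex^'n^'n \<Rightarrow> complex^'n^'n" +
  assumes diagonal_iff: "A \<in> SU \<Longrightarrow> diagonal_matrix (\<psi> A) \<longleftrightarrow> diagonal_matrix A"

text \<open>A regular diagonal matrix has abelian centralizer, so its image is regular as well.\<close>

lemma (in SU_automorphism) conjugate_preserves_torus:
  "\<exists>U\<in>SU. SU_torus_automorphism (\<lambda>A. adjoint_matrix U ** \<psi> A ** U)"
proof -
  obtain u :: "'n \<Rightarrow> complex" where u: "u \<in> torus" "inj u"
    using torus_regular_exists by blast
  have uSU: "diag_matrix u \<in> SU" using u by (simp add: diag_matrix_in_SU)
  obtain U w where U: "U \<in> SU" and w: "\<psi> (diag_matrix u) = U ** diag_matrix w ** adjoint_matrix U"
    using SU_diagonalization[OF closed[OF uSU]] by blast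
  define \<theta> where "\<theta> = (\<lambda>A. adjoint_matrix U ** \<psi> A ** U)"
  have "\<theta> = (\<lambda>A. adjoint_matrix U ** A ** U) \<circ> \<psi>"
    by (auto simp: \<theta>_def)
  then have "\<theta> \<in> iso special_unitary_group special_unitary_group"
    using iso_set_trans[OF iso conj_SU_iso[OF U]] by simp
  then interpret \<theta>: SU_automorphism \<theta> by unfold_locales
  have \<theta>u: "\<theta> (diag_matrix u) = diag_matrix w"
    unfolding \<theta>_def w using SU_adjoint_mult[OF U]
    by (metis matrix_mul_assoc matrix_mul_lid matrix_mul_rid)
  have centr: "\<theta> A ** diag_matrix w = diag_matrix w ** \<theta> A \<longleftrightarrow> diagonal_matrix A" if "A \<in> SU" for A
    using \<theta>.commute_iff[OF that uSU] diagonal_iff_commute_regular[OF u(2), of A]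
    by (simp add: \<theta>u diagonal_matrix_def)
  have "inj w"
  proof (rule injI, rule ccontr)
    fix i j assume wij: "w i = w j" and ij: "i \<noteq> j"
    \<comment> \<open>Both blocks act inside the eigenspace of \<open>diag_matrix w\<close> spanned
      by the coordinates \<open>i\<close>, \<open>j\<close>, hence lie in its centralizer; they
      correspond to two unit quaternions that do not commute.\<close>
    let ?B = "quaternion_block i j 0 1" and ?C = "quaternion_block i j \<i> 0"
    obtain A D where A: "A \<in> SU" "\<theta> A = ?B" and D: "D \<in> SU" "\<theta> D = ?C"
      using \<theta>.surj[of ?B] \<theta>.surj[of ?C] quaternion_block_SU[OF ij, of 0 1]
        quaternion_block_SU[OF ij, of \<i> 0] by auto
    have "diagonal_matrix A" "diagonal_matrix D"
      using centr A D quaternion_block_commute_diag[OF wij] by metis+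
    then have "A ** D = D ** A" by (auto simp: diagonal_matrix_def diag_matrix_mult mult.commute)
    then have "?B ** ?C = ?C ** ?B" using A D \<theta>.commute_iff by metis
    then have "(?B ** ?C) $ j $ i = (?C ** ?B) $ j $ i" by simp
    then show False using ij by (simp add: quaternion_block_mult) (simp add: quaternion_block_def)
  qed
  then have "diagonal_matrix (\<theta> A) \<longleftrightarrow> diagonal_matrix A" if "A \<in> SU" for A
    using centr[OF that] diagonal_iff_commute_regular[of w "\<theta> A"] by (simp add: diagonal_matrix_def)
  then have "SU_torus_automorphism \<theta>" by unfold_locales
  then show ?thesis using U unfolding \<theta>_def by blast
qed

text \<open>On a two-element set this is a single equality of coordinates, stated without ordering
  the pair. Such sets are the edges of the complete graph on the indices.\<close>

definition const_on :: "('n \<Rightarrow> 'a) \<Rightarrow> 'n set \<Rightarrow> bool" where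
  "const_on u e \<longleftrightarrow> (\<forall>i\<in>e. \<forall>j\<in>e. u i = u j)"

lemma const_on_pair [simp]: "const_on u {i, j} \<longleftrightarrow> u i = u j"
  by (auto simp: const_on_def)

lemma torus_merging_pair_exists:
  fixes i j :: "'n::finite"
  shows "\<exists>u\<in>torus. \<forall>k l. u k = u l \<longleftrightarrow> k = l \<or> {k, l} = {i, j}"
proof -
  obtain g :: "'n \<Rightarrow> nat" where g: "inj g"
    using finite_imp_inj_to_nat_seg[of "UNIV :: 'n set"] by auto
  have "(g(j := g i)) k = (g(j := g i)) l \<longleftrightarrow> k = l \<or> {k, l} = {i, j}" for k l
    using g by (auto simp: inj_def doubleton_eq_iff)
  then show ?thesis
    using torus_with_partition_exists[of "g(j := g i)"] by simp
qed

lemma torus_merging_triple_exists: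
  fixes a b c :: "'n::finite"
  shows "\<exists>u\<in>torus. \<forall>k l. u k = u l \<longleftrightarrow> k = l \<or> {k, l} \<subseteq> {a, b, c}"
proof -
  obtain g :: "'n \<Rightarrow> nat" where g: "inj g"
    using finite_imp_inj_to_nat_seg[of "UNIV :: 'n set"] by auto
  let ?g = "g(b := g a, c := g a)"
  have "?g k = ?g l \<longleftrightarrow> k = l \<or> {k, l} \<subseteq> {a, b, c}" for k l
    using g by (auto simp: inj_def)
  then show ?thesis
    using torus_with_partition_exists[of ?g] by simp
qed

lemma torus_merging_two_pairs_exists:
  fixes a b c d :: "'n::finite"
  assumes "{a, b} \<inter> {c, d} = {}"
  shows "\<exists>u\<in>torus. \<forall>k l. u k = u l \<longleftrightarrow> k = l \<or> {k, l} = {a, b} \<or> {k, l} = {c, d}"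
proof -
  obtain g :: "'n \<Rightarrow> nat" where g: "inj g"
    using finite_imp_inj_to_nat_seg[of "UNIV :: 'n set"] by auto
  let ?g = "g(b := g a, d := g c)"
  have "?g k = ?g l \<longleftrightarrow> k = l \<or> {k, l} = {a, b} \<or> {k, l} = {c, d}" for k l
    using g assms by (auto simp: inj_def doubleton_eq_iff)
  then show ?thesis
    using torus_with_partition_exists[of ?g] by simp
qed

text \<open>Characterizes triangles by implications between coincidences of coordinates, which
  automorphisms respect. If \<open>A\<close> and \<open>B\<close> were disjoint, an element merging
  exactly these two pairs would violate the implication; if they share a vertex, an element merging
  exactly their three vertices confines \<open>C\<close> to them.\<close>

lemma triangle_if_implied:
  fixes A B C :: "'n::finite set"
  assumes card: "card A = 2" "card B = 2" "card C = 2"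
    and distinct: "A \<noteq> B" "A \<noteq> C" "B \<noteq> C"
    and implied: "\<And>v. v \<in> torus \<Longrightarrow> const_on v A \<Longrightarrow> const_on v B \<Longrightarrow> const_on v C"
  shows "\<exists>a b c. a \<noteq> b \<and> a \<noteq> c \<and> b \<noteq> c \<and> A = {a, b} \<and> B = {a, c} \<and> C = {b, c}"
proof -
  obtain p q where C: "C = {p, q}" "p \<noteq> q" using card(3) by (auto simp: card_2_iff)
  have "A \<inter> B \<noteq> {}"
  proof
    assume disj: "A \<inter> B = {}"
    obtain a b where A: "A = {a, b}" "a \<noteq> b" using card(1) by (auto simp: card_2_iff)
    obtain c d where B: "B = {c, d}" "c \<noteq> d" using card(2) by (auto simp: card_2_iff)
    obtain u where "u \<in> torus" and
      u: "\<forall>k l. u k = u l \<longleftrightarrow> k = l \<or> {k, l} = {a, b} \<or> {k, l} = {c, d}"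
      using torus_merging_two_pairs_exists[OF disj[unfolded A B]] by blast
    have "const_on u C"
      by (rule implied[OF \<open>u \<in> torus\<close>]) (simp_all add: A B u)
    then have "C = A \<or> C = B" using C(2) by (simp add: A B C(1) u)
    then show False using distinct by blast
  qed
  then obtain a where a: "a \<in> A" "a \<in> B" by blast
  then obtain b where A: "A = {a, b}" "a \<noteq> b" using card(1) by (auto simp: card_2_iff)
  obtain c where B: "B = {a, c}" "a \<noteq> c" using card(2) a(2) by (auto simp: card_2_iff)
  have "b \<noteq> c" using A B distinct by blast
  obtain u where "u \<in> torus" and u: "\<And>k l. u k = u l \<longleftrightarrow> k = l \<or> {k, l} \<subseteq> {a, b, c}"
    using torus_merging_triple_exists by metis
  have "const_on u C"
    by (rule implied[OF \<open>u \<in> torus\<close>]) (simp_all add: A B u)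
  then have "{p, q} \<subseteq> {a, b, c}" using C(2) by (simp add: C(1) u)
  then have "C = {b, c}" using C distinct A B \<open>b \<noteq> c\<close> by auto
  then show ?thesis using A B \<open>b \<noteq> c\<close> by blast
qed

section \<open>Action on the torus and on pairs of indices\<close>

context SU_torus_automorphism
begin

definition \<tau> :: "('n \<Rightarrow> complex) \<Rightarrow> 'n \<Rightarrow> complex" where
  "\<tau> u = (\<lambda>i. \<psi> (diag_matrix u) $ i $ i)"

lemma \<psi>_diag: "u \<in> torus \<Longrightarrow> \<psi> (diag_matrix u) = diag_matrix (\<tau> u)"
proof -
  assume "u \<in> torus"
  then have "diagonal_matrix (\<psi> (diag_matrix u))"
    using diagonal_iff diag_matrix_in_SU by (metis diagonal_matrix_def)
  then obtain v where v: "\<psi> (diag_matrix u) = diag_matrix v" by (auto simp: diagonal_matrix_def)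
  have "\<tau> u = v" by (simp add: \<tau>_def v) (simp add: diag_matrix_def)
  then show ?thesis using v by simp
qed

lemma \<tau>_closed: "u \<in> torus \<Longrightarrow> \<tau> u \<in> torus"
  by (metis \<psi>_diag closed diag_matrix_in_SU)

lemma \<tau>_mult: "u \<in> torus \<Longrightarrow> v \<in> torus \<Longrightarrow> \<tau> (\<lambda>i. u i * v i) = (\<lambda>i. \<tau> u i * \<tau> v i)"
  using mult[of "diag_matrix u" "diag_matrix v"] torus_mult[of u v]
  by (simp add: diag_matrix_in_SU \<psi>_diag diag_matrix_mult)

lemma \<tau>_surj:
  assumes "v \<in> torus" shows "\<exists>u\<in>torus. \<tau> u = v"
proof -
  obtain A where A: "A \<in> SU" "\<psi> A = diag_matrix v"
    using surj assms diag_matrix_in_SU by blast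
  then have "diagonal_matrix A" using diagonal_iff by (metis diagonal_matrix_def)
  then obtain u where "A = diag_matrix u" by (auto simp: diagonal_matrix_def)
  then show ?thesis using A \<psi>_diag diag_matrix_in_SU by (metis diag_matrix_eq_iff)
qed

text \<open>The double centralizer condition quantifies over all of \<open>SU\<close>, and
  \<open>\<psi>\<close> permutes \<open>SU\<close> while preserving and reflecting
  commutation.\<close>

lemma \<tau>_coarser_iff:
  assumes uv: "u \<in> torus" "v \<in> torus"
  shows "(\<forall>i j. \<tau> u i = \<tau> u j \<longrightarrow> \<tau> v i = \<tau> v j) \<longleftrightarrow> (\<forall>i j. u i = u j \<longrightarrow> v i = v j)"
proof -
  have 1: "diag_matrix u \<in> SU" "diag_matrix v \<in> SU" using uv by (simp_all add: diag_matrix_in_SU)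
  have ball: "(\<forall>A\<in>SU. P A) \<longleftrightarrow> (\<forall>A\<in>SU. P (\<psi> A))" for P
    using closed surj by metis
  have "(\<forall>A\<in>SU. A ** \<psi> (diag_matrix u) = \<psi> (diag_matrix u) ** A \<longrightarrow>
      A ** \<psi> (diag_matrix v) = \<psi> (diag_matrix v) ** A) \<longleftrightarrow>
    (\<forall>A\<in>SU. \<psi> A ** \<psi> (diag_matrix u) = \<psi> (diag_matrix u) ** \<psi> A \<longrightarrow>
      \<psi> A ** \<psi> (diag_matrix v) = \<psi> (diag_matrix v) ** \<psi> A)"
    by (rule ball)
  also have "\<dots> \<longleftrightarrow> (\<forall>A\<in>SU. A ** diag_matrix u = diag_matrix u ** A \<longrightarrow>
      A ** diag_matrix v = diag_matrix v ** A)"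
    using commute_iff 1 by (intro ball_cong refl) simp
  finally show ?thesis
    unfolding coarser_iff_double_centralizer \<psi>_diag[OF uv(1)] \<psi>_diag[OF uv(2)] .
qed

text \<open>In the preorder of coarseness, which \<open>\<tau>\<close> respects in both directions,
  the elements with exactly one coincident pair are the minimal nonregular ones. Hence such an
  element goes to another one, and its pair to a pair.\<close>

lemma edge_image:
  assumes e: "card e = 2"
  shows "\<exists>e'. card e' = 2 \<and> (\<forall>u\<in>torus. const_on u e \<longleftrightarrow> const_on (\<tau> u) e')"
proof -
  obtain i j where ij: "e = {i, j}" "i \<noteq> j" using e by (auto simp: card_2_iff)
  obtain r :: "'n \<Rightarrow> complex" where r: "r \<in> torus" "inj r" using torus_regular_exists by blast
  obtain r' where r': "r' \<in> torus" "\<tau> r' = r" using \<tau>_surj[OF r(1)] by blast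
  obtain c where c: "c \<in> torus" and ceq: "\<And>k l. c k = c l \<longleftrightarrow> k = l \<or> {k, l} = {i, j}"
    using torus_merging_pair_exists by metis
  have "\<not> inj (\<tau> c)"
  proof
    assume "inj (\<tau> c)"
    then have "\<forall>i j. \<tau> c i = \<tau> c j \<longrightarrow> \<tau> r i = \<tau> r j" by (auto simp: inj_def)
    then have "c i = c j \<longrightarrow> r i = r j" using \<tau>_coarser_iff[OF c r(1)] by blast
    then show False using r(2) ij ceq by (auto simp: inj_def)
  qed
  then obtain k l where kl: "\<tau> c k = \<tau> c l" "k \<noteq> l" by (auto simp: inj_def)
  \<comment> \<open>The element \<open>d\<close> merges only the pair \<open>k\<close>,
    \<open>l\<close>, so it is finer than \<open>\<tau> c\<close>. Its preimage is nonregular and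
    finer than \<open>c\<close>, hence has the same coincidences as \<open>c\<close>; so
    \<open>\<tau> c\<close> merges nothing else.\<close>
  obtain d where d: "d \<in> torus" and deq: "\<And>p q. d p = d q \<longleftrightarrow> p = q \<or> {p, q} = {k, l}"
    using torus_merging_pair_exists by metis
  obtain d' where d': "d' \<in> torus" "\<tau> d' = d" using \<tau>_surj[OF d] by blast
  have "\<forall>p q. d p = d q \<longrightarrow> \<tau> c p = \<tau> c q" using kl by (auto simp: deq doubleton_eq_iff)
  then have d'c: "d' p = d' q \<Longrightarrow> c p = c q" for p q
    using \<tau>_coarser_iff[OF d'(1) c] d'(2) by blast
  have "\<not> inj d'"
  proof
    assume "inj d'"
    then have "\<forall>i j. d' i = d' j \<longrightarrow> r' i = r' j" by (auto simp: inj_def)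
    then have "d k = d l \<longrightarrow> r k = r l"
      using \<tau>_coarser_iff[OF d'(1) r'(1)] unfolding d' r' by blast
    then show False using r(2) kl(2) deq by (auto simp: inj_def)
  qed
  then obtain p q where pq: "d' p = d' q" "p \<noteq> q" by (auto simp: inj_def)
  then have "{p, q} = {i, j}" using d'c ceq by blast
  then have "d' i = d' j" using pq(1) by (auto simp: doubleton_eq_iff)
  then have "\<forall>a b. c a = c b \<longrightarrow> d' a = d' b" by (auto simp: ceq doubleton_eq_iff)
  then have cd: "\<tau> c a = \<tau> c b \<Longrightarrow> d a = d b" for a b
    using \<tau>_coarser_iff[OF c d'(1)] unfolding d' by blast
  have "u i = u j \<longleftrightarrow> \<tau> u k = \<tau> u l" if "u \<in> torus" for u
  proof
    assume "u i = u j"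
    then have "\<forall>a b. c a = c b \<longrightarrow> u a = u b" by (auto simp: ceq doubleton_eq_iff)
    then show "\<tau> u k = \<tau> u l" using \<tau>_coarser_iff[OF c that] kl(1) by blast
  next
    assume *: "\<tau> u k = \<tau> u l"
    have "\<tau> u a = \<tau> u b" if "\<tau> c a = \<tau> c b" for a b
      using cd[OF that] * by (auto simp: deq doubleton_eq_iff)
    then have "\<forall>a b. c a = c b \<longrightarrow> u a = u b" using \<tau>_coarser_iff[OF c that] by blast
    then show "u i = u j" by (simp add: ceq)
  qed
  then show ?thesis using kl(2) by (intro exI[of _ "{k, l}"]) (simp add: ij)
qed

text \<open>An automorphism of the complete graph's edge set that preserves triangles maps the star at a
  vertex to a star: two of its edges share a vertex, and every further edge meets both of
  them without closing the triangle.\<close>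

theorem index_permutation:
  assumes n: "CARD('n) \<ge> 3"
  shows "\<exists>p. inj p \<and> (\<forall>u\<in>torus. \<forall>i j. u i = u j \<longleftrightarrow> \<tau> u (p i) = \<tau> u (p j))"
proof -
  obtain f where f: "\<And>e. card e = 2 \<Longrightarrow> card (f e) = 2"
    "\<And>e u. card e = 2 \<Longrightarrow> u \<in> torus \<Longrightarrow> const_on u e \<longleftrightarrow> const_on (\<tau> u) (f e)"
    using edge_image by metis
  have f_inj: "e = e'" if ee: "card e = 2" "card e' = 2" "f e = f e'" for e e'
  proof -
    obtain i j where ij: "e = {i, j}" "i \<noteq> j" using ee(1) by (auto simp: card_2_iff)
    obtain k l where kl: "e' = {k, l}" "k \<noteq> l" using ee(2) by (auto simp: card_2_iff)
    obtain c where c: "c \<in> torus" "\<And>k l. c k = c l \<longleftrightarrow> k = l \<or> {k, l} = {i, j}"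
      using torus_merging_pair_exists by metis
    have "const_on c e" by (simp add: ij c)
    then have "const_on c e'" using f(2)[OF ee(1) c(1)] f(2)[OF ee(2) c(1)] ee(3) by simp
    then show ?thesis using ij kl c(2) by simp
  qed
  have tri: "\<exists>a b c. a \<noteq> b \<and> a \<noteq> c \<and> b \<noteq> c \<and> f {i, j} = {a, b} \<and> f {i, k} = {a, c} \<and> f {j, k} = {b, c}"
    if "i \<noteq> j" "i \<noteq> k" "j \<noteq> k" for i j k
  proof (rule triangle_if_implied)
    have e: "card {i, j} = 2" "card {i, k} = 2" "card {j, k} = 2" using that by auto
    then show "card (f {i, j}) = 2" "card (f {i, k}) = 2" "card (f {j, k}) = 2"
      using f(1) by auto
    show "f {i, j} \<noteq> f {i, k}" "f {i, j} \<noteq> f {j, k}" "f {i, k} \<noteq> f {j, k}"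
      using f_inj[OF e(1,2)] f_inj[OF e(1,3)] f_inj[OF e(2,3)] that
      by (auto simp: doubleton_eq_iff)
    fix v assume v: "v \<in> torus" "const_on v (f {i, j})" "const_on v (f {i, k})"
    then obtain u where u: "u \<in> torus" "\<tau> u = v" using \<tau>_surj by blast
    show "const_on v (f {j, k})"
      using v f(2)[OF e(1) u(1)] f(2)[OF e(2) u(1)] f(2)[OF e(3) u(1)] u(2) by auto
  qed
  obtain i0 j0 k0 :: 'n where ijk: "i0 \<noteq> j0" "i0 \<noteq> k0" "j0 \<noteq> k0"
  proof -
    obtain S :: "'n set" where "card S = 3" using n obtain_subset_with_card_n by metis
    then show ?thesis using that by (auto simp: card_3_iff)
  qed
  obtain a b c where abc: "a \<noteq> b" "a \<noteq> c" "b \<noteq> c" "f {i0, j0} = {a, b}" "f {i0, k0} = {a, c}"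
    "f {j0, k0} = {b, c}"
    using tri[OF ijk] by auto
  \<comment> \<open>An edge that meets {a, b} and {a, c} but avoids \<open>a\<close> can only be {b,
    c}, already the image of the opposite side \<open>{j0, k0}\<close>.\<close>
  have star: "a \<in> f {i0, l}" if l: "l \<noteq> i0" for l
  proof (rule ccontr)
    assume na: "a \<notin> f {i0, l}"
    have lj: "l \<noteq> j0" "l \<noteq> k0" using na abc by auto
    have "f {i0, j0} \<inter> f {i0, l} \<noteq> {}" using tri[of i0 j0 l] ijk l lj by auto
    moreover have "f {i0, k0} \<inter> f {i0, l} \<noteq> {}" using tri[of i0 k0 l] ijk l lj by auto
    ultimately have "b \<in> f {i0, l}" "c \<in> f {i0, l}" using abc na by auto
    moreover have "card (f {i0, l}) = 2" using f(1)[of "{i0, l}"] l by auto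
    ultimately have "f {i0, l} = f {j0, k0}"
      using abc by (auto simp: card_2_iff)
    then have "{i0, l} = {j0, k0}" using f_inj[of "{i0, l}" "{j0, k0}"] l ijk by simp
    then show False using ijk by (auto simp: doubleton_eq_iff)
  qed
  have "\<exists>q. q \<noteq> a \<and> f {i0, j} = {a, q}" if "j \<noteq> i0" for j
    using star[OF that] f(1)[of "{i0, j}"] that by (auto simp: card_2_iff)
  then obtain q where q: "\<And>j. j \<noteq> i0 \<Longrightarrow> q j \<noteq> a" "\<And>j. j \<noteq> i0 \<Longrightarrow> f {i0, j} = {a, q j}"
    by metis
  \<comment> \<open>The centre \<open>i0\<close> goes to the centre \<open>a\<close> of the image
    star, every other vertex to the free end of its edge.\<close>
  define p where "p = q(i0 := a)"
  have q_inj: "q j \<noteq> q k" if "j \<noteq> i0" "k \<noteq> i0" "j \<noteq> k" for j k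
    using f_inj[of "{i0, j}" "{i0, k}"] q(2)[of j] q(2)[of k] that by (auto simp: doubleton_eq_iff)
  have "inj p"
    by (rule injI) (use q(1) q_inj in \<open>force simp: p_def split: if_splits\<close>)
  have fp: "f {j, k} = {p j, p k}" if jk: "j \<noteq> k" for j k
  proof -
    consider "j = i0" | "k = i0" | "j \<noteq> i0" "k \<noteq> i0" by blast
    then show ?thesis
    proof cases
      case 1 then show ?thesis using q(2)[of k] that by (simp add: p_def)
    next
      case 2 then show ?thesis using q(2)[of j] that by (simp add: p_def insert_commute)
    next
      case 3
      obtain x y z where xyz: "x \<noteq> y" "x \<noteq> z" "y \<noteq> z" "f {i0, j} = {x, y}" "f {i0, k} = {x, z}"
        "f {j, k} = {y, z}"
        using tri[of i0 j k] 3 jk by auto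
      then have "{x, y} = {a, q j}" "{x, z} = {a, q k}" using q(2) 3 by auto
      then have "y = q j" "z = q k" using xyz q_inj[of j k] 3 that by (auto simp: doubleton_eq_iff)
      then show ?thesis using xyz 3 by (simp add: p_def)
    qed
  qed
  have "u i = u j \<longleftrightarrow> \<tau> u (p i) = \<tau> u (p j)" if "u \<in> torus" for u i j
  proof (cases "i = j")
    case False
    then show ?thesis using f(2)[of "{i, j}" u] fp[OF False] that by simp
  qed simp
  then show ?thesis using \<open>inj p\<close> by blast
qed

end

subsection \<open>Continuous automorphisms of the circle\<close>

text \<open>Repeated square roots of i are fixed up to sign by multiplicativity, and the sign is
  settled by keeping the right half circle invariant. Their powers have dense angles, so continuity
  finishes the argument.\<close>

lemma circle_endomorphism_fixing_i:
  fixes \<gamma> :: "complex \<Rightarrow> complex"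
  assumes norm: "\<And>z. cmod z = 1 \<Longrightarrow> cmod (\<gamma> z) = 1"
    and mult: "\<And>z w. cmod z = 1 \<Longrightarrow> cmod w = 1 \<Longrightarrow> \<gamma> (z * w) = \<gamma> z * \<gamma> w"
    and inj: "\<And>z. cmod z = 1 \<Longrightarrow> \<gamma> z = 1 \<Longrightarrow> z = 1"
    and cont: "continuous_on (sphere 0 1) \<gamma>"
    and i: "\<gamma> \<i> = \<i>"
    and z: "cmod z = 1"
  shows "\<gamma> z = z"
proof -
  have one: "\<gamma> 1 = 1"
    using mult[of 1 1] norm[of 1] by auto
  have cont_cis: "continuous_on S (\<lambda>t. \<gamma> (cis t))" for S
    by (rule continuous_on_compose2[OF cont]) (auto intro: continuous_intros)
  have minus_i: "\<gamma> (- \<i>) = - \<i>"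
  proof -
    have "\<gamma> (-\<i>) * \<i> = 1" using mult[of "-\<i>" \<i>] one i by simp
    then show ?thesis by (metis complex_i_mult_minus i_squared minus_mult_minus mult.right_neutral mult_minus_right
        mult.assoc mult.commute)
  qed
  have inj2: "z = w" if "cmod z = 1" "cmod w = 1" "\<gamma> z = \<gamma> w" for z w
  proof -
    have "\<gamma> (z * cnj w) * \<gamma> w = \<gamma> z"
      using that mult[of "z * cnj w" w] by (simp add: norm_mult mult.assoc cmod_1_iff)
    then have "\<gamma> (z * cnj w) = 1" using that norm[of w] by auto
    then have "z * cnj w = 1" using inj[of "z * cnj w"] that by (simp add: norm_mult)
    then have "z * (cnj w * w) = w" by (metis mult.assoc mult_1)
    moreover have "cnj w * w = 1" using that(2) cmod_1_iff by blast
    ultimately show ?thesis by (metis mult.right_neutral)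
  qed
  text \<open>The open right half circle is connected and avoids the fixed points \<open>\<i>\<close> and \<open>-\<i>\<close>.\<close>
  have pos: "Re (\<gamma> (cis t)) > 0" if t: "-(pi/2) < t" "t < pi/2" for t
  proof (rule ccontr)
    let ?I = "{-(pi/2)<..<pi/2}" and ?h = "\<lambda>t. Re (\<gamma> (cis t))"
    assume "\<not> ?h t > 0"
    moreover have "connected (?h ` ?I)"
      by (intro connected_continuous_image continuous_intros cont_cis) auto
    moreover have "?h t \<in> ?h ` ?I" "1 \<in> ?h ` ?I"
      using t one by (auto intro!: image_eqI[of _ _ 0])
    ultimately have "0 \<in> ?h ` ?I"
      using connected_contains_Icc[of "?h ` ?I" "?h t" 1] by (auto simp: subset_iff)
    then obtain s where s: "s \<in> ?I" "?h s = 0" by auto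
    have "cmod (\<gamma> (cis s)) = 1" using norm by simp
    then have "\<bar>Im (\<gamma> (cis s))\<bar> = 1" using s(2) by (simp add: cmod_def)
    then have "Im (\<gamma> (cis s)) = 1 \<or> Im (\<gamma> (cis s)) = -1" by linarith
    then have "\<gamma> (cis s) = \<i> \<or> \<gamma> (cis s) = -\<i>" using s(2) by (auto simp: complex_eq_iff)
    then have "cis s = \<i> \<or> cis s = -\<i>"
      using inj2[of "cis s" \<i>] inj2[of "cis s" "-\<i>"] i minus_i by auto
    then have "cos s = 0" by (auto simp: complex_eq_iff)
    then show False using cos_gt_zero_pi[of s] s(1) by auto
  qed
  have dyadic: "\<gamma> (cis (pi / 2 ^ Suc k)) = cis (pi / 2 ^ Suc k)" for k
  proof (induction k)
    case 0
    then show ?case using i by simp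
  next
    case (Suc k)
    let ?w = "cis (pi / 2 ^ Suc (Suc k))"
    have "?w * ?w = cis (pi / 2 ^ Suc k)" by (simp add: cis_mult)
    then have "(\<gamma> ?w)\<^sup>2 = ?w\<^sup>2"
      using Suc mult[of ?w ?w] by (simp add: power2_eq_square)
    then have "\<gamma> ?w = ?w \<or> \<gamma> ?w = - ?w" by (simp add: power2_eq_iff)
    moreover have "pi / 2 ^ Suc (Suc k) < pi / 2"
    proof (rule divide_strict_left_mono)
      show "(2::real) < 2 ^ Suc (Suc k)" using one_less_power[of "2::real" "Suc k"] by simp
    qed auto
    then have b: "-(pi/2) < pi / 2 ^ Suc (Suc k)" "pi / 2 ^ Suc (Suc k) < pi / 2"
      by (auto intro: less_trans[of _ 0])
    have "Re ?w > 0" using cos_gt_zero_pi[OF b] by simp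
    ultimately show ?case using pos[OF b] by auto
  qed
  have power: "\<gamma> (cis t ^ m) = \<gamma> (cis t) ^ m" for t m
    by (induction m) (simp_all add: one mult norm_power)
  have multiple: "\<gamma> (cis (real m * (pi / 2 ^ Suc k))) = cis (real m * (pi / 2 ^ Suc k))" for m k
    using power[of "pi / 2 ^ Suc k" m] by (simp only: dyadic Complex.DeMoivre)
  obtain t where t: "t \<ge> 0" "z = cis t"
    using z Arg2pi_ge_0[of z] Arg2pi_eq[of z] by (metis cis_conv_exp mult_1 of_real_1)
  \<comment> \<open>The largest multiple of pi / 2^(k+1) not exceeding \<open>t\<close>; the
    truncation by \<open>nat\<close> is harmless because \<open>t\<close> is nonnegative.\<close>
  define x where "x k = real (nat \<lfloor>t * 2 ^ Suc k / pi\<rfloor>) * (pi / 2 ^ Suc k)" for k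
  have "(\<lambda>k. t - pi / 2 ^ Suc k) \<longlonglongrightarrow> t" by real_asymp
  moreover have "t - pi / 2 ^ Suc k \<le> x k \<and> x k \<le> t" for k
  proof -
    let ?y = "t * 2 ^ Suc k / pi"
    have y: "?y - 1 \<le> real (nat \<lfloor>?y\<rfloor>)" "real (nat \<lfloor>?y\<rfloor>) \<le> ?y"
      using t(1) by (auto simp: of_nat_nat)
    have "(?y - 1) * (pi / 2 ^ Suc k) \<le> x k" "x k \<le> ?y * (pi / 2 ^ Suc k)"
      unfolding x_def by (rule mult_right_mono[OF y(1)] mult_right_mono[OF y(2)]; simp)+
    moreover have "(?y - 1) * (pi / 2 ^ Suc k) = t - pi / 2 ^ Suc k" "?y * (pi / 2 ^ Suc k) = t"
      by (simp_all add: field_simps)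
    ultimately show ?thesis by metis
  qed
  ultimately have x: "x \<longlonglongrightarrow> t"
    by (intro tendsto_sandwich[of "\<lambda>k. t - pi / 2 ^ Suc k" x _ "\<lambda>_. t"]) auto
  have "(\<lambda>k. \<gamma> (cis (x k))) \<longlonglongrightarrow> \<gamma> (cis t)"
    by (rule continuous_on_tendsto_compose[OF cont_cis[of UNIV] x]) auto
  moreover have "(\<lambda>k. cis (x k)) \<longlonglongrightarrow> cis t"
    by (intro tendsto_intros x)
  moreover have "\<gamma> (cis (x k)) = cis (x k)" for k
    unfolding x_def by (rule multiple)
  ultimately show ?thesis using t(2) LIMSEQ_unique by (metis (no_types, lifting) ext)
qed

lemma cmod_Re_eq_1:
  assumes "cmod z = 1" "Re z = 1" shows "z = 1"
proof -
  have "(Im z)\<^sup>2 = 0" using cmod_power2[of z] assms by simp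
  then show ?thesis using assms(2) by (simp add: complex_eq_iff)
qed

text \<open>The last hypothesis is an order-theoretic substitute for continuity at \<open>1\<close>.\<close>

lemma circle_automorphism_cases:
  fixes \<beta> :: "complex \<Rightarrow> complex"
  assumes norm: "\<And>z. cmod z = 1 \<Longrightarrow> cmod (\<beta> z) = 1"
    and mult: "\<And>z w. cmod z = 1 \<Longrightarrow> cmod w = 1 \<Longrightarrow> \<beta> (z * w) = \<beta> z * \<beta> w"
    and inj: "\<And>z. cmod z = 1 \<Longrightarrow> \<beta> z = 1 \<Longrightarrow> z = 1"
    and surj: "\<And>w. cmod w = 1 \<Longrightarrow> \<exists>z. cmod z = 1 \<and> \<beta> z = w"
    and bound: "\<And>z w. cmod z = 1 \<Longrightarrow> cmod w = 1 \<Longrightarrow> Re (w\<^sup>2) < 1 \<Longrightarrow> Re (w\<^sup>2) \<le> Re z \<Longrightarrow>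
      cmod (\<beta> z - 1) \<le> 2 * cmod (\<beta> w - 1)"
  shows "(\<forall>z. cmod z = 1 \<longrightarrow> \<beta> z = z) \<or> (\<forall>z. cmod z = 1 \<longrightarrow> \<beta> z = cnj z)"
proof -
  have one: "\<beta> 1 = 1"
    using mult[of 1 1] norm[of 1] by auto
  have near_1: "\<exists>d>0. \<forall>z. cmod z = 1 \<longrightarrow> cmod (z - 1) < d \<longrightarrow> cmod (\<beta> z - 1) < e" if "e > 0" for e
  proof -
    have "(cis \<longlongrightarrow> cis 0) (at_right 0)"
      by (intro tendsto_intros)
    then have "eventually (\<lambda>t. dist (cis t) 1 < e / 2) (at_right 0)"
      using \<open>e > 0\<close> tendstoD[of cis 1 "at_right 0" "e / 2"] by simp
    moreover have "eventually (\<lambda>t. t \<in> {0<..<pi/2}) (at_right (0::real))"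
      by (rule eventually_at_right_real) auto
    ultimately have "eventually (\<lambda>t. dist (cis t) 1 < e / 2 \<and> t \<in> {0<..<pi/2}) (at_right 0)"
      by (rule eventually_conj)
    then obtain t where "dist (cis t) 1 < e / 2 \<and> t \<in> {0<..<pi/2}"
      using eventually_happens'[OF trivial_limit_at_right_real] by blast
    then have t: "cmod (cis t - 1) < e / 2" "0 < t" "t < pi/2" by (auto simp: dist_norm)
    \<comment> \<open>Nothing is known about the position of \<open>w\<close>, only that
      \<open>\<beta> w\<close> is close to 1. Since \<open>t\<close> lies strictly between 0 and
      pi/2, \<open>w\<^sup>2\<close> is not 1, so the arc Re z >= Re (w^2) is a neighbourhood of 1
      on which \<open>bound\<close> applies with this \<open>w\<close>.\<close>
    obtain w where w: "cmod w = 1" "\<beta> w = cis t" using surj[of "cis t"] by auto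
    have "Re (w\<^sup>2) \<noteq> 1"
    proof
      assume "Re (w\<^sup>2) = 1"
      moreover have "cmod (w\<^sup>2) = 1" using w by (simp add: norm_power)
      ultimately have "w\<^sup>2 = 1" by (rule cmod_Re_eq_1[rotated])
      then have "cis t * cis t = 1" using mult[OF w(1) w(1)] one w(2) by (simp add: power2_eq_square)
      then have "sin (2 * t) = 0" by (simp add: cis_mult complex_eq_iff)
      then show False using sin_gt_zero[of "2 * t"] t by auto
    qed
    moreover have "Re (w\<^sup>2) \<le> 1"
      using complex_Re_le_cmod[of "w\<^sup>2"] w by (simp add: norm_power)
    ultimately have lt: "Re (w\<^sup>2) < 1" by simp
    have "cmod (\<beta> z - 1) < e" if z: "cmod z = 1" "cmod (z - 1) < 1 - Re (w\<^sup>2)" for z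
    proof -
      have "1 - Re z \<le> cmod (z - 1)" using complex_Re_le_cmod[of "1 - z"] by (simp add: norm_minus_commute)
      then have "Re (w\<^sup>2) \<le> Re z" using z(2) by linarith
      then have "cmod (\<beta> z - 1) \<le> 2 * cmod (\<beta> w - 1)" by (rule bound[OF z(1) w(1) lt])
      then show ?thesis using t(1) w(2) by simp
    qed
    then show ?thesis using lt by (intro exI[of _ "1 - Re (w\<^sup>2)"]) auto
  qed
  have diff: "cmod (\<beta> z - \<beta> w) = cmod (\<beta> (z * cnj w) - 1)" "cmod (z - w) = cmod (z * cnj w - 1)"
    if "cmod z = 1" "cmod w = 1" for z w
  proof -
    have w: "cnj w * w = 1" using that cmod_1_iff by blast
    have zw: "z * cnj w * w = z" using w by (simp add: mult.assoc)
    have "\<beta> z = \<beta> (z * cnj w) * \<beta> w"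
      using mult[of "z * cnj w" w, unfolded zw] that by (simp add: norm_mult)
    then have "\<beta> z - \<beta> w = (\<beta> (z * cnj w) - 1) * \<beta> w" by (simp add: algebra_simps)
    then show "cmod (\<beta> z - \<beta> w) = cmod (\<beta> (z * cnj w) - 1)"
      using norm[of w] that by (simp add: norm_mult)
    have "z - w = (z * cnj w - 1) * w" using w by (simp add: algebra_simps)
    then show "cmod (z - w) = cmod (z * cnj w - 1)"
      using that by (simp add: norm_mult)
  qed
  have cont: "continuous_on (sphere 0 1) \<beta>"
    unfolding continuous_on_iff
  proof (intro ballI allI impI)
    fix w :: complex and e :: real assume w: "w \<in> sphere 0 1" and e: "0 < e"
    obtain d where d: "d > 0" "\<And>z. cmod z = 1 \<Longrightarrow> cmod (z - 1) < d \<Longrightarrow> cmod (\<beta> z - 1) < e"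
      using near_1[OF e] by blast
    show "\<exists>d>0. \<forall>z\<in>sphere 0 1. dist z w < d \<longrightarrow> dist (\<beta> z) (\<beta> w) < e"
    proof (intro exI[of _ d] conjI ballI impI d(1))
      fix z :: complex assume z: "z \<in> sphere 0 1" "dist z w < d"
      have zw: "cmod z = 1" "cmod w = 1" using z w by auto
      then have "cmod (\<beta> (z * cnj w) - 1) < e"
        using z(2) by (intro d(2)) (simp_all add: norm_mult dist_norm flip: diff(2))
      then show "dist (\<beta> z) (\<beta> w) < e" by (simp only: dist_norm diff(1)[OF zw])
    qed
  qed
  have "(\<beta> \<i>)\<^sup>2 = \<beta> (-1)" using mult[of \<i> \<i>] by (simp add: power2_eq_square)
  moreover have "(\<beta> (-1))\<^sup>2 = 1" using mult[of "-1" "-1"] one by (simp add: power2_eq_square)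
  then have "\<beta> (-1) = -1" using inj[of "-1"] by (auto simp: power2_eq_1_iff)
  ultimately have "(\<beta> \<i>)\<^sup>2 = \<i>\<^sup>2" by simp
  then consider "\<beta> \<i> = \<i>" | "\<beta> \<i> = - \<i>" using power2_eq_iff by blast
  then show ?thesis
  proof cases
    case 1
    then show ?thesis using circle_endomorphism_fixing_i[OF norm mult inj cont] by blast
  next
    case 2
    have "cnj (\<beta> z) = z" if "cmod z = 1" for z
    proof (rule circle_endomorphism_fixing_i[of "\<lambda>z. cnj (\<beta> z)"])
      show "continuous_on (sphere 0 1) (\<lambda>z. cnj (\<beta> z))" by (intro continuous_intros cont)
      show "z = 1" if "cmod z = 1" "cnj (\<beta> z) = 1" for z
        using inj[of z] that by (metis complex_cnj_cancel_iff complex_cnj_one)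
    qed (use norm mult 2 that in auto)
    then show ?thesis by (metis complex_cnj_cnj)
  qed
qed

subsection \<open>Automorphisms preserve the real part of the trace\<close>

text \<open>For unit \<open>z\<close> this is the coroot one-parameter subgroup of the torus:
  \<open>cnj z\<close> is the inverse of \<open>z\<close>, and the values form the diagonal torus of
  the SU_2 in the coordinates \<open>i\<close>, \<open>j\<close>.\<close>

definition coroot :: "'n \<Rightarrow> 'n \<Rightarrow> complex \<Rightarrow> 'n \<Rightarrow> complex" where
  "coroot i j z = (\<lambda>k. if k = i then z else if k = j then cnj z else 1)"

lemma coroot_torus:
  fixes i j :: "'n::finite"
  assumes "i \<noteq> j" "cmod z = 1" shows "coroot i j z \<in> torus"
proof -
  have "(\<Prod>k\<in>UNIV. coroot i j z k) = (\<Prod>k\<in>{i, j}. coroot i j z k)"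
    by (rule prod.mono_neutral_right) (auto simp: coroot_def)
  then show ?thesis using assms by (auto simp: torus_def coroot_def cmod_1_iff mult.commute)
qed

lemma diag_coroot: "i \<noteq> j \<Longrightarrow> diag_matrix (coroot i j z) = quaternion_block i j z 0"
  by (simp add: vec_eq_iff diag_matrix_def quaternion_block_def coroot_def)

text \<open>A unit quaternion block has determinant one and trace 2 Re A, so its eigenvalues are
  \<open>w\<close> and \<open>cnj w\<close>. A normalized \<open>w\<close>-eigenvector is the first
  column of \<open>Y\<close>, and the quaternion form supplies the second.\<close>

lemma quaternion_block_diagonalization:
  fixes i j :: "'n::finite"
  assumes ij: "i \<noteq> j" and AB: "A * cnj A + B * cnj B = 1" and w: "cmod w = 1" "Re A = Re w"
  shows "\<exists>Y\<in>SU. quaternion_block i j A B = Y ** quaternion_block i j w 0 ** adjoint_matrix Y"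
proof -
  have w1: "w * cnj w = 1" using w(1) by (simp add: cmod_1_iff mult.commute)
  have Aw: "A + cnj A = w + cnj w" using w(2) by (simp add: complex_eq_iff)
  have "\<exists>a b. a * cnj a + b * cnj b = 1 \<and> A * a - cnj B * b = a * w \<and> B * a + cnj A * b = b * w"
  proof (cases "B = 0 \<and> w = cnj A")
    case True
    then show ?thesis by (intro exI[of _ 0] exI[of _ 1]) simp
  next
    case False
    \<comment> \<open>The second row of the eigenvector equation for (a, B) gives this
      \<open>a\<close>; the vector vanishes exactly in the case treated before.\<close>
    define a where "a = w - cnj A"
    define r where "r = (cmod a)\<^sup>2 + (cmod B)\<^sup>2"
    have "r > 0" using False by (auto simp: r_def a_def sum_power2_gt_zero_iff)
    define c where "c = complex_of_real (1 / sqrt r)"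
    have cr: "c * cnj c * complex_of_real r = 1"
    proof -
      have "c * cnj c * complex_of_real r = of_real (1 / sqrt r * (1 / sqrt r) * r)"
        by (simp only: c_def complex_cnj_complex_of_real of_real_mult)
      then show ?thesis using \<open>r > 0\<close> by simp
    qed
    have r: "complex_of_real r = a * cnj a + B * cnj B"
      by (simp only: r_def of_real_add complex_norm_square)
    have BB: "B * cnj B = 1 - A * cnj A" using AB by (simp add: algebra_simps)
    have "(A - w) * a = w * (A + cnj A) - w * w - A * cnj A" by (simp add: a_def algebra_simps)
    also have "\<dots> = w * cnj w - A * cnj A" by (simp add: Aw algebra_simps)
    also have "\<dots> = cnj B * B" by (simp add: w1 BB mult.commute)
    finally have 1: "A * a - cnj B * B = a * w" by (simp add: algebra_simps)
    have 2: "B * a + cnj A * B = B * w" by (simp add: a_def algebra_simps)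
    show ?thesis
    proof (rule exI[of _ "c * a"], rule exI[of _ "c * B"], intro conjI)
      have "c * a * cnj (c * a) + c * B * cnj (c * B) = c * cnj c * (a * cnj a + B * cnj B)"
        by (simp add: algebra_simps)
      then show "c * a * cnj (c * a) + c * B * cnj (c * B) = 1" using cr r by simp
      have "A * (c * a) - cnj B * (c * B) = c * (A * a - cnj B * B)" by (simp add: algebra_simps)
      then show "A * (c * a) - cnj B * (c * B) = c * a * w" by (simp add: 1)
      have "B * (c * a) + cnj A * (c * B) = c * (B * a + cnj A * B)" by (simp add: algebra_simps)
      then show "B * (c * a) + cnj A * (c * B) = c * B * w" by (simp add: 2)
    qed
  qed
  then obtain a b where ab: "a * cnj a + b * cnj b = 1" "A * a - cnj B * b = a * w"
    "B * a + cnj A * b = b * w" by blast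
  let ?Y = "quaternion_block i j a b"
  have Y: "?Y \<in> SU" by (rule quaternion_block_SU[OF ij ab(1)])
  have "quaternion_block i j A B ** ?Y = ?Y ** quaternion_block i j w 0"
    by (simp add: quaternion_block_mult[OF ij] ab)
  then have "quaternion_block i j A B ** (?Y ** adjoint_matrix ?Y) =
      ?Y ** quaternion_block i j w 0 ** adjoint_matrix ?Y"
    by (simp only: matrix_mul_assoc)
  then show ?thesis using Y SU_mult_adjoint[OF Y] by auto
qed

text \<open>Every rotation whose angle is at most twice that of \<open>w\<close> is conjugate to a commutator of \<open>w\<close>
  with a real rotation, by the intermediate choice of the rotation angle.\<close>

lemma coroot_conjugate_to_commutator:
  fixes i j :: "'n::finite"
  assumes ij: "i \<noteq> j" and z: "cmod z = 1" and w: "cmod w = 1"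
    and lt: "Re (w\<^sup>2) < 1" and le: "Re (w\<^sup>2) \<le> Re z"
  shows "\<exists>X\<in>SU. \<exists>Y\<in>SU. diag_matrix (coroot i j z) =
    Y ** (X ** diag_matrix (coroot i j w) ** adjoint_matrix X ** adjoint_matrix (diag_matrix (coroot i j w)))
      ** adjoint_matrix Y"
proof -
  \<comment> \<open>The squared sine of the rotation angle, solved from Re z = 1 - q (1 - Re (w^2)),
    whose right side is the real part of the commutator's first entry.\<close>
  define q where "q = (1 - Re z) / (1 - Re (w\<^sup>2))"
  have "Re z \<le> 1" using complex_Re_le_cmod[of z] z by simp
  then have q: "0 \<le> q" "q \<le> 1" using lt le by (simp_all add: q_def)
  define s where "s = complex_of_real (sqrt q)"
  define c where "c = complex_of_real (sqrt (1 - q))"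
  have s2: "s * s = of_real q" and c2: "c * c = of_real (1 - q)" and cs: "cnj s = s" "cnj c = c"
    using q by (simp_all add: s_def c_def flip: of_real_mult)
  have sc: "c * c + s * s = 1" by (simp add: s2 c2)
  let ?X = "quaternion_block i j c s" and ?W = "quaternion_block i j w 0"
  have X: "?X \<in> SU" by (rule quaternion_block_SU[OF ij]) (simp add: cs sc)
  have w1: "w * cnj w = 1" using w by (simp add: cmod_1_iff mult.commute)
  define A where "A = (c * w * c + s * cnj w * s) * cnj w"
  define B where "B = (s * w * c - c * cnj w * s) * cnj w"
  have M: "?X ** ?W ** adjoint_matrix ?X ** adjoint_matrix ?W = quaternion_block i j A B"
    by (simp add: adjoint_quaternion_block[OF ij] quaternion_block_mult[OF ij] cs A_def B_def)
  have "A = c * c * (w * cnj w) + s * s * (cnj w)\<^sup>2"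
    by (simp add: A_def algebra_simps power2_eq_square)
  then have "A = of_real (1 - q) + of_real q * (cnj w)\<^sup>2" by (simp add: w1 s2 c2)
  then have "Re A = 1 - q + q * Re ((cnj w)\<^sup>2)"
    by (simp del: complex_cnj_power)
  also have "Re ((cnj w)\<^sup>2) = Re (w\<^sup>2)" by (simp add: power2_eq_square)
  finally have "Re A = 1 - q * (1 - Re (w\<^sup>2))" by (simp add: algebra_simps)
  then have ReA: "Re A = Re z" using lt by (simp add: q_def)
  have "quaternion_block i j A B \<in> SU"
    unfolding M[symmetric] using X diag_matrix_in_SU coroot_torus[OF ij w]
    by (metis SU_adjoint SU_mult diag_coroot ij)
  then have "A * cnj A + B * cnj B = 1" by (simp add: SU_iff det_quaternion_block[OF ij])
  then obtain Y where Y: "Y \<in> SU"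
    "quaternion_block i j A B = Y ** quaternion_block i j z 0 ** adjoint_matrix Y"
    using quaternion_block_diagonalization[OF ij _ z ReA] by blast
  have "adjoint_matrix Y ** quaternion_block i j A B ** Y
      = (adjoint_matrix Y ** Y) ** quaternion_block i j z 0 ** (adjoint_matrix Y ** Y)"
    unfolding Y(2) by (simp only: matrix_mul_assoc)
  then have "quaternion_block i j z 0 = adjoint_matrix Y ** quaternion_block i j A B ** Y"
    using SU_adjoint_mult[OF Y(1)] by simp
  then show ?thesis
    using X SU_adjoint[OF Y(1)] M unfolding diag_coroot[OF ij]
    by (intro bexI[of _ ?X] bexI[of _ "adjoint_matrix Y"]) simp_all
qed

lemma matrix_sub_ldistrib: "A ** (B - C) = A ** B - A ** C" for A :: "complex^'n^'m"
  by (simp add: vec_eq_iff matrix_matrix_mult_def right_diff_distrib sum_subtractf)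

lemma matrix_sub_rdistrib: "(A - B) ** C = A ** C - B ** C" for C :: "complex^'n^'m"
  by (simp add: vec_eq_iff matrix_matrix_mult_def left_diff_distrib sum_subtractf)

text \<open>Right multiplication by \<open>G\<close> is isometric and turns the commutator minus 1
  into the conjugate of \<open>G - mat 1\<close> by \<open>X\<close>, minus
  \<open>G - mat 1\<close>. The bound is uniform in \<open>X\<close>, so it remains usable when
  \<open>X\<close> is replaced by an uncontrolled image.\<close>

lemma norm_commutator_le:
  fixes X G :: "complex^'n^'n"
  assumes X: "X \<in> SU" and G: "G \<in> SU"
  shows "norm (X ** G ** adjoint_matrix X ** adjoint_matrix G - mat 1) \<le> 2 * norm (G - mat 1)"
proof -
  have "(X ** G ** adjoint_matrix X ** adjoint_matrix G - mat 1) ** G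
      = X ** G ** adjoint_matrix X ** (adjoint_matrix G ** G) - G"
    by (simp only: matrix_sub_rdistrib matrix_mul_assoc matrix_mul_lid)
  also have "\<dots> = X ** (G - mat 1) ** adjoint_matrix X - (G - mat 1)"
    using SU_adjoint_mult[OF G] SU_mult_adjoint[OF X]
    by (simp add: matrix_sub_rdistrib matrix_sub_ldistrib)
  finally have "norm (X ** G ** adjoint_matrix X ** adjoint_matrix G - mat 1)
      = norm (X ** (G - mat 1) ** adjoint_matrix X - (G - mat 1))"
    using norm_SU_mult_right[OF G] by metis
  also have "\<dots> \<le> norm (X ** (G - mat 1) ** adjoint_matrix X) + norm (G - mat 1)"
    by (rule norm_triangle_ineq4)
  also have "\<dots> = 2 * norm (G - mat 1)"
    using X by (simp add: norm_SU_mult_right[OF SU_adjoint[OF X]] norm_SU_mult_left)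
  finally show ?thesis .
qed

lemma norm_conj_minus_one:
  fixes Y M :: "complex^'n^'n"
  assumes Y: "Y \<in> SU"
  shows "norm (Y ** M ** adjoint_matrix Y - mat 1) = norm (M - mat 1)"
proof -
  have "Y ** M ** adjoint_matrix Y - mat 1 = Y ** (M - mat 1) ** adjoint_matrix Y"
    using SU_mult_adjoint[OF Y] by (simp add: matrix_sub_rdistrib matrix_sub_ldistrib)
  then show ?thesis
    using Y by (simp add: norm_SU_mult_right[OF SU_adjoint[OF Y]] norm_SU_mult_left)
qed

lemma norm_coroot_minus_one:
  fixes i j :: "'n::finite"
  assumes ij: "i \<noteq> j"
  shows "norm (diag_matrix (coroot i j z) - mat 1) = sqrt 2 * cmod (z - 1)"
proof -
  have "diag_matrix (coroot i j z) - mat 1 = diag_matrix (\<lambda>k. coroot i j z k - 1)"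
    by (simp add: vec_eq_iff diag_matrix_def mat_def)
  moreover have "diag_matrix v \<bullet> diag_matrix v = (\<Sum>k\<in>UNIV. (cmod (v k))\<^sup>2)" for v :: "'n \<Rightarrow> complex"
    by (simp add: inner_matrix adjoint_diag_matrix diag_matrix_mult trace_diag_matrix
        flip: complex_norm_square)
  moreover have "(\<Sum>k\<in>UNIV. (cmod (coroot i j z k - 1))\<^sup>2) = (\<Sum>k\<in>{i, j}. (cmod (coroot i j z k - 1))\<^sup>2)"
    by (rule sum.mono_neutral_right) (auto simp: coroot_def)
  moreover have "\<dots> = 2 * (cmod (z - 1))\<^sup>2"
    using ij complex_mod_cnj[of "z - 1"] by (simp add: coroot_def)
  ultimately show ?thesis
    by (simp add: norm_eq_sqrt_inner real_sqrt_mult)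
qed

lemma torus_ratio_exists:
  fixes i :: "'n::finite"
  assumes "cmod z = 1"
  shows "\<exists>u\<in>torus. (\<forall>k. k \<noteq> i \<longrightarrow> u i / u k = z) \<and> (\<forall>k l. k \<noteq> i \<longrightarrow> l \<noteq> i \<longrightarrow> u k = u l)"
proof -
  define v where "v k = (if k = i then z else 1)" for k
  have "cmod (v k) = 1" for k using assms by (simp add: v_def)
  then obtain c where c: "cmod c = 1" "(\<lambda>k. c * v k) \<in> torus"
    using torus_scaling_exists by blast
  then have "c \<noteq> 0" by auto
  then show ?thesis by (intro bexI[OF _ c(2)]) (simp add: v_def)
qed

text \<open>Entrywise roots are free except at one index, where the product condition on
  \<open>v\<close> dictates the entry; the product condition on \<open>u\<close> makes its power
  correct. This divisibility later removes roots of unity.\<close>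

lemma torus_root_exists:
  fixes u :: "'n::finite \<Rightarrow> complex"
  assumes u: "u \<in> torus" and m: "0 < m"
  shows "\<exists>v\<in>torus. u = (\<lambda>i. v i ^ m)"
proof -
  have "\<exists>w. cmod w = 1 \<and> w ^ m = u i" for i
    using exists_complex_unit_root[OF torus_cmod[OF u] m] .
  then obtain w where w: "\<And>i. cmod (w i) = 1" "\<And>i. w i ^ m = u i" by metis
  obtain k :: 'n where True by simp
  define v where "v = w(k := cnj (\<Prod>i\<in>UNIV - {k}. w i))"
  have *: "prod g UNIV = g k * (\<Prod>i\<in>UNIV - {k}. g i)" for g :: "'n \<Rightarrow> complex"
    by (simp add: prod.remove)
  have c1: "cmod (\<Prod>i\<in>UNIV - {k}. w i) = 1" using w by (simp add: prod_norm[symmetric])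
  have "(\<Prod>i\<in>UNIV. v i) = cnj (\<Prod>i\<in>UNIV - {k}. w i) * (\<Prod>i\<in>UNIV - {k}. w i)"
    unfolding * by (simp add: v_def)
  then have v1: "(\<Prod>i\<in>UNIV. v i) = 1" using c1 by (simp only: cmod_1_iff)
  have "cmod (v i) = 1" for i using w c1 complex_mod_cnj by (simp add: v_def del: cnj_prod)
  then have v: "v \<in> torus" using v1 by (simp add: torus_def)
  have vu: "v i ^ m = u i" if "i \<noteq> k" for i using that w by (simp add: v_def)
  have "(\<Prod>i\<in>UNIV. v i ^ m) = 1" using v1 by (simp flip: prod_power_distrib)
  moreover have "(\<Prod>i\<in>UNIV. u i) = 1" using u by (simp add: torus_def)
  moreover have "(\<Prod>i\<in>UNIV - {k}. v i ^ m) = (\<Prod>i\<in>UNIV - {k}. u i)"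
    using vu by (intro prod.cong) auto
  moreover have "(\<Prod>i\<in>UNIV - {k}. u i) \<noteq> 0" using torus_nz[OF u] by simp
  ultimately have "v k ^ m = u k" unfolding * by (metis mult_right_cancel)
  then have "u = (\<lambda>i. v i ^ m)" using vu by (metis ext)
  then show ?thesis using v by blast
qed

lemma torus_power: "u \<in> torus \<Longrightarrow> (\<lambda>i. u i ^ m) \<in> torus"
  by (induction m) (simp_all add: torus_one torus_mult)

lemma torus_cnj: "u \<in> torus \<Longrightarrow> (\<lambda>i. cnj (u i)) \<in> torus"
  by (simp add: torus_def flip: cnj_prod)

section \<open>The circle automorphism behind a torus automorphism\<close>

context SU_torus_automorphism
begin

lemma \<tau>_power: "u \<in> torus \<Longrightarrow> \<tau> (\<lambda>i. u i ^ m) = (\<lambda>i. \<tau> u i ^ m)"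
proof (induction m)
  case 0
  have "\<tau> (\<lambda>i. 1) = (\<lambda>i. \<tau> (\<lambda>i. 1) i * \<tau> (\<lambda>i. 1) i)"
    using \<tau>_mult[OF torus_one torus_one] by simp
  then have "\<tau> (\<lambda>i. 1) i = 1" for i
    using torus_nz[OF \<tau>_closed[OF torus_one], of i] by (metis mult_cancel_right2)
  then show ?case by auto
next
  case (Suc m)
  then show ?case using \<tau>_mult[OF _ torus_power[of u m]] by simp
qed

text \<open>The permutation \<open>p\<close> makes every ratio \<open>u\<^sub>i / u\<^sub>j\<close> determine the corresponding ratio of the
  image, and with at least three indices the resulting circle maps all coincide.\<close>

lemma circle_automorphism_exists:
  assumes n: "CARD('n) \<ge> 3"
  shows "\<exists>p \<beta>. inj p \<and>
    (\<forall>u\<in>torus. \<forall>i j. i \<noteq> j \<longrightarrow> \<tau> u (p i) / \<tau> u (p j) = \<beta> (u i / u j)) \<and>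
    (\<forall>z. cmod z = 1 \<longrightarrow> cmod (\<beta> z) = 1) \<and>
    (\<forall>z w. cmod z = 1 \<longrightarrow> cmod w = 1 \<longrightarrow> \<beta> (z * w) = \<beta> z * \<beta> w) \<and>
    (\<forall>z. cmod z = 1 \<longrightarrow> \<beta> z = 1 \<longrightarrow> z = 1) \<and>
    (\<forall>w. cmod w = 1 \<longrightarrow> (\<exists>z. cmod z = 1 \<and> \<beta> z = w))"
proof -
  obtain p where p: "inj p" and eq: "\<And>u i j. u \<in> torus \<Longrightarrow> u i = u j \<longleftrightarrow> \<tau> u (p i) = \<tau> u (p j)"
    using index_permutation[OF n] by blast
  define r where "r i j u = \<tau> u (p i) / \<tau> u (p j)" for i j u
  have nz: "u i \<noteq> 0" "\<tau> u i \<noteq> 0" if "u \<in> torus" for u i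
    using torus_nz[OF that] torus_nz[OF \<tau>_closed[OF that]] by auto
  \<comment> \<open>Equal ratios mean that the quotient of \<open>u\<close> by \<open>v\<close>
    takes equal values at \<open>i\<close> and \<open>j\<close>, so its image does at
    \<open>p i\<close> and \<open>p j\<close>.\<close>
  have same: "r i j u = r i j v" if uv: "u \<in> torus" "v \<in> torus" "u i / u j = v i / v j" for i j u v
  proof -
    let ?w = "\<lambda>i. u i / v i"
    have w: "?w \<in> torus" by (rule torus_divide[OF uv(1,2)])
    have "?w i = ?w j" using uv(3) nz(1)[OF uv(1)] nz(1)[OF uv(2)] by (simp add: field_simps)
    then have "\<tau> ?w (p i) = \<tau> ?w (p j)" using eq[OF w] by blast
    moreover have "\<tau> u = (\<lambda>i. \<tau> ?w i * \<tau> v i)"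
      using \<tau>_mult[OF w uv(2)] nz(1)[OF uv(2)] by simp
    ultimately show ?thesis using nz(2)[OF w] by (simp add: r_def)
  qed
  have step1: "r i j u = r i l v"
    if uv: "u \<in> torus" "v \<in> torus" "u i / u j = v i / v l" "i \<noteq> j" "i \<noteq> l" for i j l u v
  proof -
    have "cmod (u i / u j) = 1" using torus_cmod[OF uv(1)] by (simp add: norm_divide)
    then obtain w where w: "w \<in> torus" "\<And>k. k \<noteq> i \<Longrightarrow> w i / w k = u i / u j"
      "\<And>k l. k \<noteq> i \<Longrightarrow> l \<noteq> i \<Longrightarrow> w k = w l" using torus_ratio_exists[of _ i] by metis
    have "r i j u = r i j w" using same[OF uv(1) w(1)] w(2) uv by metis
    also have "\<dots> = r i l w" using eq[OF w(1), of j l] w(3)[of j l] uv by (simp add: r_def)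
    also have "\<dots> = r i l v" using same[OF uv(2) w(1)] w(2) uv by metis
    finally show ?thesis .
  qed
  have inv: "r i j u = inverse (r j i u)" for i j u by (simp add: r_def)
  have step2: "r i j u = r k j v"
    if uv: "u \<in> torus" "v \<in> torus" "u i / u j = v k / v j" "i \<noteq> j" "k \<noteq> j" for i j k u v
  proof -
    have "inverse (u i / u j) = inverse (v k / v j)" using uv(3) by simp
    then have "u j / u i = v j / v k" by (simp add: inverse_eq_divide)
    then show ?thesis using step1[OF uv(1,2), of j i k] uv(4,5) inv[of i j u] inv[of k j v] by simp
  qed
  have ratio: "\<exists>u\<in>torus. u i / u j = z" if "cmod z = 1" "i \<noteq> j" for z i j
    using torus_ratio_exists[OF that(1), of i] that(2)[symmetric] by blast
  have all: "r i j u = r k l v"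
    if uv: "u \<in> torus" "v \<in> torus" "u i / u j = v k / v l" "i \<noteq> j" "k \<noteq> l" for i j k l u v
  proof -
    have z: "cmod (u i / u j) = 1" using torus_cmod[OF uv(1)] by (simp add: norm_divide)
    show ?thesis
    proof (cases "l = i")
      case False
      then have "i \<noteq> l" by simp
      then obtain w where w: "w \<in> torus" "w i / w l = u i / u j" using ratio[OF z] by blast
      have "r i j u = r i l w" using step1[OF uv(1) w(1)] w(2) uv(4) \<open>i \<noteq> l\<close> by metis
      also have "\<dots> = r k l v" using step2[OF w(1) uv(2)] w(2) uv(3,5) \<open>i \<noteq> l\<close> by metis
      finally show ?thesis .
    next
      case True
      \<comment> \<open>The pairs (i, j) and (k, i) cannot be joined by changing one index at a time
        directly; a third index \<open>m\<close> gives the route (i, j), (m, j), (m, i), (k,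
        i).\<close>
      have "card {i, j} < CARD('n)" using n by (cases "i = j") auto
      then have "\<not> UNIV \<subseteq> {i, j}" using card_mono[of "{i, j}" UNIV] by auto
      then obtain m where m: "m \<noteq> i" "m \<noteq> j" by blast
      obtain w where w: "w \<in> torus" "w m / w j = u i / u j" using ratio[OF z] m by blast
      obtain w' where w': "w' \<in> torus" "w' m / w' i = u i / u j" using ratio[OF z] m by blast
      have "r i j u = r m j w" using step2[OF uv(1) w(1)] w(2) uv(4) m by metis
      also have "\<dots> = r m i w'" using step1[OF w(1) w'(1)] w(2) w'(2) m by metis
      also have "\<dots> = r k l v" using step2[OF w'(1) uv(2), of m i k] w'(2) uv(3,5) m True by metis
      finally show ?thesis .
    qed
  qed
  have "2 \<le> CARD('n)" using n by simp
  then obtain S :: "'n set" where "card S = 2" using obtain_subset_with_card_n by blast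
  then obtain a b :: 'n where ab: "a \<noteq> b" by (auto simp: card_2_iff)
  have "\<forall>z. \<exists>u. cmod z = 1 \<longrightarrow> u \<in> torus \<and> u a / u b = z" using ratio[OF _ ab] by blast
  then obtain s where s: "\<And>z. cmod z = 1 \<Longrightarrow> s z \<in> torus" "\<And>z. cmod z = 1 \<Longrightarrow> s z a / s z b = z"
    by metis
  define \<beta> where "\<beta> z = r a b (s z)" for z
  have \<beta>: "r i j u = \<beta> (u i / u j)" if u: "u \<in> torus" "i \<noteq> j" for u i j
  proof -
    have z: "cmod (u i / u j) = 1" using torus_cmod[OF u(1)] by (simp add: norm_divide)
    show ?thesis
      unfolding \<beta>_def by (rule all[OF u(1) s(1)[OF z] _ u(2) ab]) (rule s(2)[OF z, symmetric])
  qed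
  have "cmod (\<beta> z) = 1" if z: "cmod z = 1" for z
  proof -
    obtain u where u: "u \<in> torus" "u a / u b = z" using ratio[OF z ab] by blast
    have "cmod (r a b u) = 1" by (simp add: r_def norm_divide torus_cmod[OF \<tau>_closed[OF u(1)]])
    then show ?thesis using \<beta>[OF u(1) ab] u(2) by simp
  qed
  moreover have "\<beta> (z * w) = \<beta> z * \<beta> w" if zw: "cmod z = 1" "cmod w = 1" for z w
  proof -
    obtain u where u: "u \<in> torus" "u a / u b = z" using ratio[OF zw(1) ab] by blast
    obtain v where v: "v \<in> torus" "v a / v b = w" using ratio[OF zw(2) ab] by blast
    have "r a b (\<lambda>i. u i * v i) = r a b u * r a b v" by (simp add: r_def \<tau>_mult u v)
    moreover have "u a * v a / (u b * v b) = z * w" using u(2) v(2) by (simp flip: times_divide_times_eq)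
    ultimately show ?thesis
      using \<beta>[OF torus_mult[OF u(1) v(1)] ab] \<beta>[OF u(1) ab] \<beta>[OF v(1) ab] u(2) v(2)
      by (simp del: times_divide_eq_left times_divide_eq_right divide_divide_eq_left divide_divide_eq_right)
  qed
  moreover have "z = 1" if z: "cmod z = 1" "\<beta> z = 1" for z
  proof -
    obtain u where u: "u \<in> torus" "u a / u b = z" using ratio[OF z(1) ab] by blast
    then have "\<tau> u (p a) = \<tau> u (p b)" using \<beta>[OF u(1) ab] z(2) by (simp add: r_def)
    then have "u a = u b" using eq u(1) by blast
    then show ?thesis using u nz by auto
  qed
  moreover have "\<exists>z. cmod z = 1 \<and> \<beta> z = w" if w: "cmod w = 1" for w
  proof -
    have "p a \<noteq> p b" using p ab by (auto dest: injD)
    then obtain v where v: "v \<in> torus" "v (p a) / v (p b) = w" using ratio[OF w] by blast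
    then obtain u where u: "u \<in> torus" "\<tau> u = v" using \<tau>_surj by blast
    have "\<beta> (u a / u b) = w" using \<beta>[OF u(1) ab] v(2) u(2) by (simp add: r_def)
    moreover have "cmod (u a / u b) = 1" using torus_cmod[OF u(1)] by (simp add: norm_divide)
    ultimately show ?thesis by blast
  qed
  ultimately show ?thesis
    using p \<beta> unfolding r_def by (intro exI[of _ p] exI[of _ \<beta>] conjI) blast+
qed

end

lemma torus_scalar:
  fixes g :: "'n::finite \<Rightarrow> complex"
  assumes "g \<in> torus" "(\<lambda>k. c * g k) \<in> torus"
  shows "c ^ CARD('n) = 1"
  using assms by (simp add: torus_def prod.distrib)

lemma torus_permute:
  fixes p :: "'n::finite \<Rightarrow> 'n"
  assumes "inj p" "u \<in> torus" shows "(\<lambda>k. u (p k)) \<in> torus"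
proof -
  have "bij p" using assms(1) by (simp add: bij_def finite_UNIV_inj_surj)
  then have "(\<Prod>k\<in>UNIV. u (p k)) = (\<Prod>k\<in>UNIV. u k)"
    by (rule prod.reindex_bij_betw)
  then show ?thesis using assms(2) by (simp add: torus_def)
qed

context SU_torus_automorphism
begin

text \<open>Ratios fix the image of a torus element only up to a common scalar, which the product
  condition makes a \<open>CARD('n)\<close>-th root of unity. Writing the element as a
  \<open>CARD('n)\<close>-th power in the torus removes this scalar, for coroots first and then in
  general.\<close>

lemma torus_action:
  assumes n: "CARD('n) \<ge> 3"
  shows "\<exists>p. inj p \<and> ((\<forall>u\<in>torus. \<forall>k. \<tau> u (p k) = u k) \<or> (\<forall>u\<in>torus. \<forall>k. \<tau> u (p k) = cnj (u k)))"
proof -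
  let ?N = "CARD('n)"
  obtain p \<beta> where p: "inj p"
    and ratio: "\<And>u i j. u \<in> torus \<Longrightarrow> i \<noteq> j \<Longrightarrow> \<tau> u (p i) / \<tau> u (p j) = \<beta> (u i / u j)"
    and norm: "\<And>z. cmod z = 1 \<Longrightarrow> cmod (\<beta> z) = 1"
    and mult\<beta>: "\<And>z w. cmod z = 1 \<Longrightarrow> cmod w = 1 \<Longrightarrow> \<beta> (z * w) = \<beta> z * \<beta> w"
    and inj: "\<And>z. cmod z = 1 \<Longrightarrow> \<beta> z = 1 \<Longrightarrow> z = 1"
    and surj\<beta>: "\<And>w. cmod w = 1 \<Longrightarrow> \<exists>z. cmod z = 1 \<and> \<beta> z = w"
    using circle_automorphism_exists[OF n] by (elim exE conjE) blast
  have one\<beta>: "\<beta> 1 = 1" using mult\<beta>[of 1 1] norm[of 1] by auto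
  have cnj\<beta>: "\<beta> (cnj z) = cnj (\<beta> z)" if "cmod z = 1" for z
  proof -
    have "\<beta> (cnj z) * \<beta> z = 1" using mult\<beta>[of "cnj z" z] that one\<beta> by (simp add: cmod_1_iff)
    moreover have "cnj (\<beta> z) * \<beta> z = 1" using norm[OF that] by (simp only: cmod_1_iff)
    moreover have "\<beta> z \<noteq> 0" using norm[OF that] by auto
    ultimately show ?thesis by (metis mult_right_cancel)
  qed
  have power\<beta>: "\<beta> (z ^ m) = \<beta> z ^ m" if "cmod z = 1" for z m
    using that by (induction m) (simp_all add: one\<beta> mult\<beta> norm_power)
  have scaled: "\<tau> u (p k) = \<tau> u (p m) * \<beta> (u k / u m)" if "u \<in> torus" for u k m
  proof (cases "k = m")
    case True
    then show ?thesis using torus_nz[OF that] by (simp add: one\<beta>)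
  next
    case False
    then show ?thesis using ratio[OF that False] torus_nz[OF \<tau>_closed[OF that]] by (simp add: field_simps)
  qed
  have coroot_image: "\<tau> (coroot i j z) (p k) = coroot i j (\<beta> z) k" if ij: "i \<noteq> j" and z: "cmod z = 1" for i j z k
  proof -
    have up_to_scalar: "\<exists>c. c ^ ?N = 1 \<and> (\<forall>k. \<tau> (coroot i j w) (p k) = c * coroot i j (\<beta> w) k)"
      if w: "cmod w = 1" for w
    proof -
      \<comment> \<open>At a third index \<open>m\<close> the coroot equals 1, so the entry of its
        image at \<open>p m\<close> is the common scalar.\<close>
      have "card {i, j} < ?N" using n by (cases "i = j") auto
      then have "\<not> UNIV \<subseteq> {i, j}" using card_mono[of "{i, j}" UNIV] by auto
      then obtain m where m: "m \<noteq> i" "m \<noteq> j" by blast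
      have t: "coroot i j w \<in> torus" "coroot i j (\<beta> w) \<in> torus"
        using coroot_torus[OF ij] w norm by auto
      have *: "\<tau> (coroot i j w) (p k) = \<tau> (coroot i j w) (p m) * coroot i j (\<beta> w) k" for k
        using scaled[OF t(1), of k m] m w by (auto simp: coroot_def one\<beta> cnj\<beta>)
      have "(\<lambda>k. \<tau> (coroot i j w) (p k)) \<in> torus" by (rule torus_permute[OF p \<tau>_closed[OF t(1)]])
      then have "(\<lambda>k. \<tau> (coroot i j w) (p m) * coroot i j (\<beta> w) k) \<in> torus"
        using * by (metis (no_types, lifting) ext)
      then show ?thesis using torus_scalar[OF t(2)] * by blast
    qed
    obtain w where w: "cmod w = 1" "w ^ ?N = z" using exists_complex_unit_root[OF z, of ?N] by auto
    have t: "coroot i j w \<in> torus" by (rule coroot_torus[OF ij w(1)])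
    obtain c where c: "c ^ ?N = 1" "\<And>k. \<tau> (coroot i j w) (p k) = c * coroot i j (\<beta> w) k"
      using up_to_scalar[OF w(1)] by blast
    have "coroot i j z = (\<lambda>k. coroot i j w k ^ ?N)"
      using w(2) by (auto simp: coroot_def)
    then have "\<tau> (coroot i j z) (p k) = (\<tau> (coroot i j w) (p k)) ^ ?N"
      using \<tau>_power[OF t] by simp
    also have "\<dots> = coroot i j (\<beta> w) k ^ ?N" by (simp add: c power_mult_distrib)
    also have "\<dots> = coroot i j (\<beta> z) k"
      using power\<beta>[OF w(1), of ?N] w(2) by (auto simp: coroot_def)
    finally show ?thesis .
  qed
  have "2 \<le> ?N" using n by simp
  then obtain S :: "'n set" where "card S = 2" using obtain_subset_with_card_n by blast
  then obtain a b :: 'n where ab: "a \<noteq> b" by (auto simp: card_2_iff)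
  have pab: "p a \<noteq> p b" using p ab by (auto dest: injD)
  have surj_p: "surj p" using p by (simp add: finite_UNIV_inj_surj)
  have coroot_ab: "\<tau> (coroot a b z) = coroot (p a) (p b) (\<beta> z)" if "cmod z = 1" for z
  proof
    fix l obtain k where k: "l = p k" using surj_p by blast
    show "\<tau> (coroot a b z) l = coroot (p a) (p b) (\<beta> z) l"
      using coroot_image[OF ab that, of k] p unfolding k by (auto simp: coroot_def dest: injD)
  qed
  \<comment> \<open>The automorphism carries the commutator expression for one coroot to one for its
    image; the conjugating elements become unknown, but the norm estimate is uniform in
    them.\<close>
  have bound: "cmod (\<beta> z - 1) \<le> 2 * cmod (\<beta> w - 1)"
    if z: "cmod z = 1" and w: "cmod w = 1" and lt: "Re (w\<^sup>2) < 1" "Re (w\<^sup>2) \<le> Re z" for z w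
  proof -
    let ?Z = "diag_matrix (coroot a b z)" and ?W = "diag_matrix (coroot a b w)"
    let ?Z' = "diag_matrix (coroot (p a) (p b) (\<beta> z))" and ?W' = "diag_matrix (coroot (p a) (p b) (\<beta> w))"
    have W: "?W \<in> SU" using coroot_torus[OF ab w] by (simp add: diag_matrix_in_SU)
    obtain X Y where XY: "X \<in> SU" "Y \<in> SU"
      "?Z = Y ** (X ** ?W ** adjoint_matrix X ** adjoint_matrix ?W) ** adjoint_matrix Y"
      using coroot_conjugate_to_commutator[OF ab z w lt] by blast
    have "\<psi> ?Z = \<psi> Y ** (\<psi> X ** \<psi> ?W ** adjoint_matrix (\<psi> X) ** adjoint_matrix (\<psi> ?W)) ** adjoint_matrix (\<psi> Y)"
      unfolding XY(3) using XY(1,2) W by (simp add: mult SU_mult SU_adjoint adjoint)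
    moreover have "\<psi> ?Z = ?Z'" "\<psi> ?W = ?W'"
      using \<psi>_diag coroot_torus[OF ab] coroot_ab z w by auto
    ultimately have "norm (?Z' - mat 1) \<le> 2 * norm (?W' - mat 1)"
      using norm_commutator_le[OF closed[OF XY(1)] closed[OF W]] norm_conj_minus_one[OF closed[OF XY(2)]]
      by simp
    then show ?thesis by (simp add: norm_coroot_minus_one[OF pab])
  qed
  have "(\<forall>z. cmod z = 1 \<longrightarrow> \<beta> z = z) \<or> (\<forall>z. cmod z = 1 \<longrightarrow> \<beta> z = cnj z)"
    by (rule circle_automorphism_cases[OF norm mult\<beta> inj surj\<beta> bound])
  then obtain \<sigma> where \<sigma>: "\<sigma> = (\<lambda>z. z) \<or> \<sigma> = cnj" "\<And>z. cmod z = 1 \<Longrightarrow> \<beta> z = \<sigma> z"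
  proof
    assume "\<forall>z. cmod z = 1 \<longrightarrow> \<beta> z = z"
    then show thesis by (intro that[of "\<lambda>z. z"]) auto
  next
    assume "\<forall>z. cmod z = 1 \<longrightarrow> \<beta> z = cnj z"
    then show thesis by (intro that[of cnj]) auto
  qed
  have image: "\<tau> u (p k) = \<sigma> (u k)" if u: "u \<in> torus" for u k
  proof -
    obtain m :: 'n where True by simp
    obtain v where v: "v \<in> torus" "u = (\<lambda>i. v i ^ ?N)" using torus_root_exists[OF u, of ?N] by auto
    have \<sigma>v: "(\<lambda>k. \<sigma> (v k)) \<in> torus" using \<sigma>(1) v(1) torus_cnj[OF v(1)] by auto
    have div\<sigma>: "\<sigma> (x / y) = \<sigma> x / \<sigma> y" for x y using \<sigma>(1) by auto
    have \<sigma>nz: "\<sigma> (v m) \<noteq> 0" using torus_nz[OF \<sigma>v] by auto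
    define c where "c = \<tau> v (p m) / \<sigma> (v m)"
    have *: "\<tau> v (p k) = c * \<sigma> (v k)" for k
    proof -
      have "cmod (v k / v m) = 1" using torus_cmod[OF v(1)] by (simp add: norm_divide)
      then show ?thesis using scaled[OF v(1), of k m] \<sigma>(2) by (simp add: c_def div\<sigma>)
    qed
    have "(\<lambda>k. \<tau> v (p k)) \<in> torus" by (rule torus_permute[OF p \<tau>_closed[OF v(1)]])
    then have "(\<lambda>k. c * \<sigma> (v k)) \<in> torus" unfolding * .
    then have "c ^ ?N = 1" by (rule torus_scalar[OF \<sigma>v])
    then have "\<tau> u (p k) = \<sigma> (v k) ^ ?N"
      unfolding v(2) \<tau>_power[OF v(1)] by (simp add: * power_mult_distrib)
    also have "\<dots> = \<sigma> (u k)" using \<sigma>(1) v(2) by auto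
    finally show ?thesis .
  qed
  from \<sigma>(1) show ?thesis
  proof
    assume "\<sigma> = (\<lambda>z. z)"
    then show ?thesis using p image by (intro exI[of _ p]) simp
  next
    assume "\<sigma> = cnj"
    then show ?thesis using p image by (intro exI[of _ p]) simp
  qed
qed

lemma Re_trace_torus:
  assumes n: "CARD('n) \<ge> 3" and u: "u \<in> torus"
  shows "Re (trace (\<psi> (diag_matrix u))) = Re (trace (diag_matrix u))"
proof -
  obtain p where p: "inj p" and pu: "(\<forall>k. \<tau> u (p k) = u k) \<or> (\<forall>k. \<tau> u (p k) = cnj (u k))"
    using torus_action[OF n] u by blast
  have "bij p" using p by (simp add: bij_def finite_UNIV_inj_surj)
  then have "(\<Sum>k\<in>UNIV. \<tau> u k) = (\<Sum>k\<in>UNIV. \<tau> u (p k))"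
    by (rule sum.reindex_bij_betw[symmetric])
  then have "Re (\<Sum>k\<in>UNIV. \<tau> u k) = Re (\<Sum>k\<in>UNIV. u k)" using pu by auto
  then show ?thesis by (simp add: \<psi>_diag[OF u] trace_diag_matrix)
qed

end

theorem (in SU_automorphism) Re_trace:
  assumes n: "CARD('n) \<ge> 3" and A: "A \<in> SU"
  shows "Re (trace (\<psi> A)) = Re (trace A)"
proof -
  obtain U where U: "U \<in> SU" "SU_torus_automorphism (\<lambda>A. adjoint_matrix U ** \<psi> A ** U)"
    using conjugate_preserves_torus by blast
  define \<theta> where "\<theta> = (\<lambda>A. adjoint_matrix U ** \<psi> A ** U)"
  interpret \<theta>: SU_torus_automorphism \<theta> unfolding \<theta>_def by (rule U(2))
  have tr: "trace (\<theta> B) = trace (\<psi> B)" for B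
    unfolding \<theta>_def using trace_conj_SU[OF SU_adjoint[OF U(1)], of "\<psi> B"] by simp
  obtain V u where V: "V \<in> SU" "u \<in> torus" "A = V ** diag_matrix u ** adjoint_matrix V"
    using SU_diagonalization[OF A] by blast
  have u: "diag_matrix u \<in> SU" using V(2) by (simp add: diag_matrix_in_SU)
  have "\<theta> A = \<theta> V ** \<theta> (diag_matrix u) ** adjoint_matrix (\<theta> V)"
    unfolding V(3) using V(1) u by (simp add: \<theta>.mult \<theta>.adjoint SU_mult SU_adjoint)
  then have "trace (\<theta> A) = trace (\<theta> (diag_matrix u))"
    using trace_conj_SU[OF \<theta>.closed[OF V(1)]] by simp
  moreover have "trace A = trace (diag_matrix u)" unfolding V(3) by (rule trace_conj_SU[OF V(1)])
  ultimately show ?thesis using \<theta>.Re_trace_torus[OF n V(2)] tr by simp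
qed

subsection \<open>Jordan automorphisms of the matrix algebra\<close>

lemma matrix_add_rdistrib: "(A + B) ** C = A ** C + B ** C" for C :: "complex^'n^'m"
  by (simp add: vec_eq_iff matrix_matrix_mult_def distrib_right sum.distrib)

lemmas matrix_distribs = matrix_add_ldistrib matrix_add_rdistrib matrix_sub_ldistrib matrix_sub_rdistrib

definition matrix_unit :: "'n \<Rightarrow> 'n \<Rightarrow> complex^'n^'n" where
  "matrix_unit k l = (\<chi> i j. if i = k \<and> j = l then 1 else 0)"

lemma mult_matrix_unit_mult:
  fixes D D' :: "complex^'n^'n"
  shows "(D ** matrix_unit k l ** D') $ i $ j = D $ i $ k * D' $ l $ j"
proof -
  have 1: "(D ** matrix_unit k l) $ i $ m = (if m = l then D $ i $ k else 0)" for m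
    by (auto simp: matrix_matrix_mult_def matrix_unit_def if_distrib cong: if_cong)
  have "(D ** matrix_unit k l ** D') $ i $ j = (\<Sum>m\<in>UNIV. (D ** matrix_unit k l) $ i $ m * D' $ m $ j)"
    by (simp add: matrix_matrix_mult_def)
  also have "\<dots> = (\<Sum>m\<in>UNIV. if m = l then D $ i $ k * D' $ l $ j else 0)"
    unfolding 1 by (intro sum.cong) auto
  finally show ?thesis by simp
qed

text \<open>Matrix units in place of \<open>C\<close> isolate products of single entries. Where
  \<open>D\<close> has a nonzero entry \<open>D'\<close> must vanish, and then the symmetric term
  drops out of every other such relation.\<close>

lemma matrix_algebra_prime_symmetric:
  fixes D D' :: "complex^'n^'n"
  assumes "\<And>C. D ** C ** D' + D' ** C ** D = 0"
  shows "D = 0 \<or> D' = 0"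
proof (rule ccontr)
  assume "\<not> (D = 0 \<or> D' = 0)"
  then obtain i k l j where nz: "D $ i $ k \<noteq> 0" "D' $ l $ j \<noteq> 0" by (auto simp: vec_eq_iff)
  have *: "D $ i $ k * D' $ l $ j + D' $ i $ k * D $ l $ j = 0" for i j k l
    using arg_cong[OF assms[of "matrix_unit k l"], of "\<lambda>X. X $ i $ j"]
    by (simp add: mult_matrix_unit_mult)
  have "D' $ i $ k = 0" using *[of i k i k] nz(1) by (simp add: mult.commute)
  then show False using *[of i k l j] nz by simp
qed

locale matrix_jordan =
  fixes L :: "complex^'n^'n \<Rightarrow> complex^'n^'n"
  assumes lin: "linear L" and onto: "surj L"
    and jordan: "\<And>A B. L (A ** B + B ** A) = L A ** L B + L B ** L A"
begin

lemma add: "L (A + B) = L A + L B" using lin by (rule linear_add)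
lemma sub: "L (A - B) = L A - L B" using lin by (rule linear_diff)

lemma double_cancel: "A + A = B + B \<Longrightarrow> A = B" for A B :: "complex^'n^'n"
  by (simp add: vec_eq_iff)

lemma square: "L (A ** A) = L A ** L A"
  by (rule double_cancel) (use jordan[of A A] in \<open>simp only: add\<close>)

text \<open>Twice \<open>ABA\<close> is a combination of nested Jordan products: that of
  \<open>A\<close> with \<open>AB + BA\<close>, minus that of \<open>A\<^sup>2\<close> with
  \<open>B\<close>.\<close>

lemma sandwich: "L (A ** B ** A) = L A ** L B ** L A"
proof (rule double_cancel)
  have "A ** B ** A + A ** B ** A = (A ** (A ** B + B ** A) + (A ** B + B ** A) ** A) - ((A ** A) ** B + B ** (A ** A))"
    by (simp add: matrix_distribs matrix_mul_assoc)
  then have "L (A ** B ** A + A ** B ** A) =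
      L (A ** (A ** B + B ** A) + (A ** B + B ** A) ** A) - L ((A ** A) ** B + B ** (A ** A))"
    by (simp only: sub)
  also have "\<dots> = L A ** L B ** L A + L A ** L B ** L A"
    by (simp only: jordan square) (simp add: matrix_distribs matrix_mul_assoc)
  finally show "L (A ** B ** A) + L (A ** B ** A) = L A ** L B ** L A + L A ** L B ** L A"
    by (simp only: add)
qed

lemma sandwich_polarized: "L (A ** B ** C + C ** B ** A) = L A ** L B ** L C + L C ** L B ** L A"
proof -
  have "A ** B ** C + C ** B ** A = (A + C) ** B ** (A + C) - A ** B ** A - C ** B ** C"
    by (simp add: matrix_distribs)
  then have "L (A ** B ** C + C ** B ** A) = L ((A + C) ** B ** (A + C)) - L (A ** B ** A) - L (C ** B ** C)"
    by (simp only: sub)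
  also have "\<dots> = (L A + L C) ** L B ** (L A + L C) - L A ** L B ** L A - L C ** L B ** L C"
    by (simp only: sandwich add)
  finally show ?thesis by (simp add: matrix_distribs)
qed

text \<open>Evaluating \<open>L (ABCBA + BACAB)\<close> in two ways, as a polarized sandwich around \<open>C\<close> and as two
  nested sandwiches, gives the identity that primeness turns into this alternative.\<close>

lemma mult_or_antimult: "L (A ** B) = L A ** L B \<or> L (A ** B) = L B ** L A"
proof -
  define a b p where "a = L A" and "b = L B" and "p = L (A ** B)"
  have q: "L (B ** A) = a ** b + b ** a - p"
    using jordan[of A B] by (simp add: a_def b_def p_def add algebra_simps)
  have "(p - a ** b) ** X ** (p - b ** a) + (p - b ** a) ** X ** (p - a ** b) = 0" for X
  proof -
    obtain C where C: "X = L C" using onto by (metis surjD)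
    have "(A ** B) ** C ** (B ** A) + (B ** A) ** C ** (A ** B)
        = A ** (B ** C ** B) ** A + B ** (A ** C ** A) ** B"
      by (simp add: matrix_mul_assoc)
    then have "p ** X ** (a ** b + b ** a - p) + (a ** b + b ** a - p) ** X ** p
        = a ** (b ** X ** b) ** a + b ** (a ** X ** a) ** b"
      using sandwich_polarized[of "A ** B" C "B ** A"]
      by (simp add: add sandwich q C flip: a_def b_def p_def)
    then show ?thesis
      by (simp add: matrix_distribs matrix_mul_assoc) (simp add: algebra_simps)
  qed
  then have "p - a ** b = 0 \<or> p - b ** a = 0" by (rule matrix_algebra_prime_symmetric)
  then show ?thesis by (simp add: a_def b_def p_def)
qed

text \<open>For fixed \<open>A\<close> either alternative defines an additive subgroup of matrices
  \<open>B\<close>, and a group is not the union of two proper subgroups. The global version repeats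
  this in the left factor.\<close>

lemma mult_or_antimult_row:
  "(\<forall>B. L (A ** B) = L A ** L B) \<or> (\<forall>B. L (A ** B) = L B ** L A)"
proof (rule ccontr)
  assume "\<not> ?thesis"
  then obtain B C where BC: "L (A ** B) \<noteq> L A ** L B" "L (A ** C) \<noteq> L C ** L A" by blast
  then have "L (A ** B) = L B ** L A" "L (A ** C) = L A ** L C" using mult_or_antimult by blast+
  then show False
    using mult_or_antimult[of A "B + C"] BC by (auto simp: matrix_distribs add)
qed

theorem mult_or_antimult_global:
  "(\<forall>A B. L (A ** B) = L A ** L B) \<or> (\<forall>A B. L (A ** B) = L B ** L A)"
proof (rule ccontr)
  assume "\<not> ?thesis"
  then obtain A B C D where "L (A ** B) \<noteq> L A ** L B" "L (C ** D) \<noteq> L D ** L C" by blast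
  then have anti: "\<And>X. L (A ** X) = L X ** L A" and hom: "\<And>X. L (C ** X) = L C ** L X"
    and AB: "L (A ** B) \<noteq> L A ** L B" and CD: "L (C ** D) \<noteq> L D ** L C"
    using mult_or_antimult_row by blast+
  from mult_or_antimult_row[of "A + C"] show False
  proof
    assume "\<forall>X. L ((A + C) ** X) = L (A + C) ** L X"
    then have "L (A ** B) = L A ** L B" using hom by (simp add: matrix_distribs add)
    then show False using AB by simp
  next
    assume "\<forall>X. L ((A + C) ** X) = L X ** L (A + C)"
    then have "L (C ** D) = L D ** L C" using anti by (simp add: matrix_distribs add)
    then show False using CD by simp
  qed
qed

end

subsection \<open>Real polynomials in a special unitary matrix\<close>

lemma polynomial_interpolation:
  fixes g :: "complex \<Rightarrow> complex"
  assumes "finite Z"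
  shows "\<exists>q. \<forall>z\<in>Z. poly q z = g z"
  using assms
proof induction
  case (insert z Z)
  then obtain q where q: "\<And>y. y \<in> Z \<Longrightarrow> poly q y = g y" by blast
  define m where "m = (\<Prod>y\<in>Z. [:- y, 1:])"
  have m: "poly m x = (\<Prod>y\<in>Z. x - y)" for x by (simp add: m_def poly_prod)
  have "poly m z \<noteq> 0" using insert.hyps by (auto simp: m)
  moreover have "poly m y = 0" if "y \<in> Z" for y using insert.hyps(1) that by (auto simp: m)
  ultimately show ?case
    using q by (intro exI[of _ "q + smult ((g z - poly q z) / poly m z) m"]) auto
qed simp

lemma prod_cis: "finite A \<Longrightarrow> (\<Prod>i\<in>A. cis (f i)) = cis (\<Sum>i\<in>A. f i)"
  by (induction A rule: finite_induct) (simp_all add: cis_mult)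

text \<open>Distinct angles in \<open>(0, \<pi>)\<close> with sum \<open>2 \<pi>\<close> exist only for at least three indices; they are
  what makes the numbers \<open>u\<^sub>i\<close> and their conjugates pairwise distinct.\<close>

lemma torus_upper_half_regular_exists:
  assumes n: "CARD('n::finite) \<ge> 3"
  shows "\<exists>u\<in>torus. inj (u :: 'n \<Rightarrow> complex) \<and> (\<forall>i. Im (u i) > 0)"
proof -
  define N where "N = real (CARD('n))"
  have N: "N \<ge> 3" using n by (simp add: N_def)
  obtain c :: "'n \<Rightarrow> nat" where c: "bij_betw c UNIV {0..<CARD('n)}"
    using ex_bij_betw_finite_nat[of "UNIV :: 'n set"] by auto
  \<comment> \<open>The mean angle 2 pi / N is below pi because N >= 3. The distinct perturbations
    are centred, so they sum to zero, and the denominator keeps each at most 1 / (2 N) in absolute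
    value.\<close>
  define t where "t i = 2 * pi / N + (real (c i) - (N - 1) / 2) / N\<^sup>2" for i
  have c_less: "real (c i) \<le> N - 1" for i
  proof -
    have "c i < CARD('n)" using c by (auto simp: bij_betw_def)
    then show ?thesis by (simp add: N_def)
  qed
  have t_bounds: "0 < t i" "t i < pi" for i
  proof -
    have "\<bar>real (c i) - (N - 1) / 2\<bar> \<le> N / 2" using c_less[of i] N of_nat_0_le_iff[of "c i", where 'a = real] unfolding abs_le_iff
      by (intro conjI; simp add: field_simps)
    then have "\<bar>(real (c i) - (N - 1) / 2) / N\<^sup>2\<bar> \<le> (N / 2) / N\<^sup>2"
      unfolding abs_divide by (intro divide_mono) auto
    also have "(N / 2) / N\<^sup>2 = (1 / 2) / N" using N by (simp add: power2_eq_square)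
    finally have b: "\<bar>(real (c i) - (N - 1) / 2) / N\<^sup>2\<bar> \<le> (1 / 2) / N" .
    have "(1 / 2) / N < 2 * pi / N" using N pi_gt3 by (intro divide_strict_right_mono) auto
    then show "0 < t i" using b unfolding t_def abs_le_iff by linarith
    have "2 * pi / N + (1 / 2) / N = (2 * pi + 1 / 2) / N" by (simp add: add_divide_distrib)
    also have "\<dots> \<le> (2 * pi + 1 / 2) / 3" using N by (intro divide_left_mono) auto
    also have "\<dots> < pi" using pi_gt3 by simp
    finally show "t i < pi" using b unfolding t_def abs_le_iff by linarith
  qed
  have gauss: "(\<Sum>k\<in>{0..<m}. real k) = real m * (real m - 1) / 2" for m :: nat
    by (induction m) (simp_all add: field_simps)
  have "(\<Sum>i\<in>UNIV. real (c i)) = (\<Sum>k\<in>{0..<CARD('n)}. real k)"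
    by (rule sum.reindex_bij_betw[OF c])
  then have "(\<Sum>i\<in>UNIV. real (c i)) = N * ((N - 1) / 2)" by (simp add: gauss N_def)
  then have "(\<Sum>i\<in>UNIV. real (c i) - (N - 1) / 2) = 0" by (simp add: sum_subtractf N_def)
  then have "(\<Sum>i\<in>UNIV. t i) = N * (2 * pi / N)"
    by (simp add: t_def sum.distrib N_def flip: sum_divide_distrib)
  also have "\<dots> = 2 * pi" using N by simp
  finally have "(\<Prod>i\<in>UNIV. cis (t i)) = 1" by (simp add: prod_cis)
  then have torus: "(\<lambda>i. cis (t i)) \<in> torus" by (simp add: torus_def)
  have "inj (\<lambda>i. cis (t i))"
  proof (rule injI)
    fix i j assume "cis (t i) = cis (t j)"
    then have "cos (t i) = cos (t j)" by (simp add: complex_eq_iff)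
    then have "t i = t j" using cos_inj_pi t_bounds by (meson less_imp_le)
    then have "c i = c j" using N by (simp add: t_def)
    then show "i = j" using c by (auto simp: bij_betw_def inj_on_def)
  qed
  moreover have "Im (cis (t i)) > 0" for i using t_bounds[of i] by (simp add: sin_gt_zero)
  ultimately show ?thesis using torus by blast
qed

text \<open>Interpolate at the points and their conjugates with conjugate values; averaging the
  polynomial with its conjugate makes the coefficients real. Positive imaginary parts ensure that no
  node is the conjugate of another \<open>u j\<close>.\<close>

lemma real_polynomial_interpolation:
  fixes u w :: "'n::finite \<Rightarrow> complex"
  assumes "inj u" "\<And>i. Im (u i) > 0"
  shows "\<exists>(r :: nat \<Rightarrow> real) N. \<forall>i. w i = (\<Sum>k\<le>N. of_real (r k) * u i ^ k)"
proof -
  define g where "g z = (if Im z > 0 then w (inv_into UNIV u z) else cnj (w (inv_into UNIV u (cnj z))))" for z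
  have g: "g (u i) = w i" "g (cnj (u i)) = cnj (w i)" for i
    using assms(2)[of i] by (simp_all add: g_def inv_f_f[OF assms(1)])
  obtain q where q: "\<And>z. z \<in> range u \<union> range (\<lambda>i. cnj (u i)) \<Longrightarrow> poly q z = g z"
    using polynomial_interpolation[of "range u \<union> range (\<lambda>i. cnj (u i))" g] by auto
  define r where "r k = Re (coeff q k)" for k
  have "w i = (\<Sum>k\<le>degree q. of_real (r k) * u i ^ k)" for i
  proof -
    have "poly q (u i) = w i" "cnj (poly q (cnj (u i))) = w i" using q g by auto
    then have "2 * w i = poly q (u i) + cnj (poly q (cnj (u i)))" by simp
    also have "\<dots> = (\<Sum>k\<le>degree q. (coeff q k + cnj (coeff q k)) * u i ^ k)"
      by (simp add: poly_altdef algebra_simps sum.distrib)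
    also have "\<dots> = 2 * (\<Sum>k\<le>degree q. of_real (r k) * u i ^ k)"
      by (simp add: r_def complex_add_cnj sum_distrib_left algebra_simps)
    finally show ?thesis by simp
  qed
  then show ?thesis by blast
qed

primrec matrix_power :: "complex^'n^'n \<Rightarrow> nat \<Rightarrow> complex^'n^'n" where
  "matrix_power A 0 = mat 1"
| "matrix_power A (Suc k) = A ** matrix_power A k"

lemma matrix_power_add: "matrix_power A (k + l) = matrix_power A k ** matrix_power A l"
  by (induction k) (simp_all add: matrix_mul_assoc)

lemma SU_matrix_power: "A \<in> SU \<Longrightarrow> matrix_power A k \<in> SU"
  by (induction k) (simp_all add: SU_one SU_mult)

lemma matrix_power_conj_diag:
  assumes U: "U \<in> SU"
  shows "matrix_power (U ** diag_matrix u ** adjoint_matrix U) k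
    = U ** diag_matrix (\<lambda>i. u i ^ k) ** adjoint_matrix U"
proof (induction k)
  case 0
  then show ?case using SU_mult_adjoint[OF U] by (simp add: diag_matrix_one)
next
  case (Suc k)
  have "matrix_power (U ** diag_matrix u ** adjoint_matrix U) (Suc k)
      = U ** diag_matrix u ** (adjoint_matrix U ** U) ** diag_matrix (\<lambda>i. u i ^ k) ** adjoint_matrix U"
    by (simp add: Suc matrix_mul_assoc)
  also have "\<dots> = U ** (diag_matrix u ** diag_matrix (\<lambda>i. u i ^ k)) ** adjoint_matrix U"
    using SU_adjoint_mult[OF U] by (simp add: matrix_mul_assoc)
  finally show ?case by (simp add: diag_matrix_mult)
qed

lemma scaleR_matrix_mult:
  fixes A B :: "complex^'n^'n"
  shows "(r *\<^sub>R A) ** B = r *\<^sub>R (A ** B)" "A ** (r *\<^sub>R B) = r *\<^sub>R (A ** B)"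
  by (simp_all add: vec_eq_iff matrix_matrix_mult_def scaleR_sum_right)

lemma zero_matrix_mult: "0 ** A = 0" "A ** 0 = 0" for A :: "complex^'n^'n"
  by (simp_all add: vec_eq_iff matrix_matrix_mult_def)

lemma diag_matrix_add: "diag_matrix (\<lambda>i. u i + v i) = diag_matrix u + diag_matrix v"
  by (simp add: vec_eq_iff diag_matrix_def)

lemma diag_matrix_scaleR: "diag_matrix (\<lambda>i. of_real r * u i) = r *\<^sub>R diag_matrix u"
  by (simp add: vec_eq_iff diag_matrix_def scaleR_conv_of_real[where 'a = complex])

text \<open>Here \<open>span\<close> is the real span, while the entries of \<open>w\<close> are
  arbitrary complex numbers; interpolation with real coefficients bridges the two.\<close>

lemma diagonal_in_span_powers:
  fixes U :: "complex^'n^'n"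
  assumes U: "U \<in> SU" and u: "inj u" "\<And>i. Im (u i) > 0"
  shows "U ** diag_matrix w ** adjoint_matrix U
    \<in> span (range (matrix_power (U ** diag_matrix u ** adjoint_matrix U)))"
proof -
  let ?A = "U ** diag_matrix u ** adjoint_matrix U"
  obtain r :: "nat \<Rightarrow> real" and N where r: "\<And>i. w i = (\<Sum>k\<le>N. of_real (r k) * u i ^ k)"
    using real_polynomial_interpolation[OF u] by blast
  have "U ** diag_matrix (\<lambda>i. \<Sum>k\<le>m. of_real (r k) * u i ^ k) ** adjoint_matrix U
      \<in> span (range (matrix_power ?A))" for m
  proof (induction m)
    case 0
    have s: "(\<lambda>i. \<Sum>k\<le>0. of_real (r k) * u i ^ k) = (\<lambda>i. of_real (r 0) * u i ^ 0)" by simp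
    have *: "U ** diag_matrix (\<lambda>i. of_real (r 0) * u i ^ 0) ** adjoint_matrix U = r 0 *\<^sub>R matrix_power ?A 0"
      by (simp only: diag_matrix_scaleR scaleR_matrix_mult matrix_power_conj_diag[OF U])
    show ?case unfolding s * by (intro span_scale span_base rangeI)
  next
    case (Suc m)
    have *: "U ** diag_matrix (\<lambda>i. (\<Sum>k\<le>m. of_real (r k) * u i ^ k) + of_real (r (Suc m)) * u i ^ Suc m) ** adjoint_matrix U
        = U ** diag_matrix (\<lambda>i. \<Sum>k\<le>m. of_real (r k) * u i ^ k) ** adjoint_matrix U
          + r (Suc m) *\<^sub>R matrix_power ?A (Suc m)"
      by (simp only: diag_matrix_add diag_matrix_scaleR matrix_distribs scaleR_matrix_mult
          matrix_power_conj_diag[OF U])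
    show ?case
      unfolding sum.atMost_Suc * by (intro span_add span_scale span_base rangeI Suc)
  qed
  note * = this
  have w: "w = (\<lambda>i. \<Sum>k\<le>N. of_real (r k) * u i ^ k)" using r by (rule ext)
  show ?thesis by (subst w) (rule *)
qed

section \<open>Hermitian matrices and complex scalars\<close>

lemma adjoint_matrix_add: "adjoint_matrix (A + B) = adjoint_matrix A + adjoint_matrix B"
  by (simp add: vec_eq_iff adjoint_matrix_def)

lemma adjoint_matrix_scaleR: "adjoint_matrix (r *\<^sub>R A) = r *\<^sub>R adjoint_matrix A"
  by (simp add: vec_eq_iff adjoint_matrix_def)

text \<open>Complex scalars are kept as matrices because a real-linear map need not commute with
  them; their images have to be tracked.\<close>

abbreviation scalar_matrix :: "complex \<Rightarrow> complex^'n^'n" where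
  "scalar_matrix c \<equiv> diag_matrix (\<lambda>_. c)"

lemma scalar_matrix_commute: "A ** scalar_matrix c = scalar_matrix c ** A"
  by (simp add: vec_eq_iff diag_matrix_mult_left diag_matrix_mult_right mult.commute)

lemma scalar_matrix_conj: "U \<in> SU \<Longrightarrow> U ** scalar_matrix c ** adjoint_matrix U = scalar_matrix c"
  by (metis SU_mult_adjoint matrix_mul_assoc matrix_mul_rid scalar_matrix_commute)

lemma hermitian_decomposition:
  fixes M :: "complex^'n^'n"
  shows "\<exists>H K. adjoint_matrix H = H \<and> adjoint_matrix K = K \<and> M = H + scalar_matrix \<i> ** K"
proof (intro exI conjI)
  let ?H = "(1/2) *\<^sub>R (M + adjoint_matrix M)"
  let ?K = "scalar_matrix (- \<i>) ** ((1/2) *\<^sub>R (M - adjoint_matrix M))"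
  show "adjoint_matrix ?H = ?H"
    by (simp add: adjoint_matrix_add adjoint_matrix_scaleR add.commute)
  show "adjoint_matrix ?K = ?K"
    by (simp add: vec_eq_iff diag_matrix_mult_left) (simp add: adjoint_matrix_def diag_matrix_mult_left algebra_simps)
  have "scalar_matrix \<i> ** ?K = (1/2) *\<^sub>R (M - adjoint_matrix M)"
    by (simp add: matrix_mul_assoc diag_matrix_mult diag_matrix_one)
  then show "M = ?H + scalar_matrix \<i> ** ?K"
    by (simp add: algebra_simps flip: scaleR_add_left)
qed

lemma central_matrix_scalar:
  fixes J :: "complex^'n^'n"
  assumes "\<And>M. J ** M = M ** J"
  shows "\<exists>c. J = scalar_matrix c"
proof -
  obtain l :: 'n where True by simp
  define c where "c = J $ l $ l"
  have "J $ i $ k = (if i = k then c else 0)" for i k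
  proof -
    have "(J ** matrix_unit k l ** mat 1) $ i $ l = (mat 1 ** matrix_unit k l ** J) $ i $ l"
      using assms[of "matrix_unit k l"] by simp
    then show ?thesis unfolding mult_matrix_unit_mult c_def[symmetric] by (simp add: mat_def)
  qed
  then have "J = scalar_matrix c" by (simp add: vec_eq_iff diag_matrix_def)
  then show ?thesis by blast
qed

lemma adjoint_matrix_zero: "adjoint_matrix 0 = 0"
  by (simp add: vec_eq_iff adjoint_matrix_def)

subsection \<open>Linear extension of a local automorphism\<close>

locale SU_local_automorphism =
  fixes \<phi> :: "complex^'n^'n \<Rightarrow> complex^'n^'n"
  assumes n: "CARD('n) \<ge> 3"
    and local: "local_automorphism special_unitary_group \<phi>"
begin

lemma closed: "A \<in> SU \<Longrightarrow> \<phi> A \<in> SU"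
  using local by (auto simp: local_automorphism_def)

lemma pair:
  assumes "A \<in> SU" "B \<in> SU"
  shows "\<exists>\<psi>. SU_automorphism \<psi> \<and> \<phi> A = \<psi> A \<and> \<phi> B = \<psi> B"
  using local assms unfolding local_automorphism_def SU_automorphism_def by blast

lemma one: "\<phi> (mat 1) = mat 1"
  using pair[OF SU_one SU_one] SU_automorphism.one by metis

lemma adjoint: "A \<in> SU \<Longrightarrow> \<phi> (adjoint_matrix A) = adjoint_matrix (\<phi> A)"
  using pair[OF SU_adjoint, of A A] SU_automorphism.adjoint by metis

text \<open>A single automorphism agrees with \<open>\<phi>\<close> at both \<open>A\<close> and its
  power.\<close>

lemma power:
  assumes A: "A \<in> SU" shows "\<phi> (matrix_power A k) = matrix_power (\<phi> A) k"
proof -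
  obtain \<psi> where \<psi>: "SU_automorphism \<psi>" "\<phi> (matrix_power A k) = \<psi> (matrix_power A k)" "\<phi> A = \<psi> A"
    using pair[OF SU_matrix_power[OF A] A] by blast
  interpret \<psi>: SU_automorphism \<psi> by (rule \<psi>(1))
  have "\<psi> (matrix_power A k) = matrix_power (\<psi> A) k"
    by (induction k) (simp_all add: \<psi>.one \<psi>.mult A SU_matrix_power)
  then show ?thesis using \<psi> by simp
qed

lemma inner:
  assumes A: "A \<in> SU" and B: "B \<in> SU" shows "\<phi> A \<bullet> \<phi> B = A \<bullet> B"
proof -
  obtain \<psi> where \<psi>: "SU_automorphism \<psi>" "\<phi> A = \<psi> A" "\<phi> B = \<psi> B"
    using pair[OF A B] by blast
  interpret \<psi>: SU_automorphism \<psi> by (rule \<psi>(1))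
  have "\<psi> A ** adjoint_matrix (\<psi> B) = \<psi> (A ** adjoint_matrix B)"
    using A B by (simp add: \<psi>.mult \<psi>.adjoint SU_adjoint)
  then show ?thesis
    using \<psi>.Re_trace[OF n SU_mult[OF A SU_adjoint[OF B]]] by (simp add: inner_matrix \<psi>)
qed

text \<open>Take \<open>A\<close> with the eigenvectors of \<open>H\<close> and fixed regular
  eigenvalues in the upper half plane. One \<open>A\<close> serves all scalars and all complex
  multiples of \<open>H\<close> at once, which lets \<open>L\<close> be multiplicative between
  them.\<close>

lemma hermitian_in_span_powers:
  fixes H :: "complex^'n^'n"
  assumes "adjoint_matrix H = H"
  shows "\<exists>A\<in>SU. \<forall>c. scalar_matrix c \<in> span (range (matrix_power A)) \<and>
    scalar_matrix c ** H \<in> span (range (matrix_power A))"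
proof -
  obtain u :: "'n \<Rightarrow> complex" where u: "u \<in> torus" "inj u" "\<And>i. Im (u i) > 0"
    using torus_upper_half_regular_exists[OF n] by blast
  have "normal_matrix H" using assms by (simp add: normal_matrix_def)
  then obtain U w where U: "U \<in> SU" "H = U ** diag_matrix w ** adjoint_matrix U"
    using normal_diagonalization_SU by blast
  let ?A = "U ** diag_matrix u ** adjoint_matrix U"
  have span: "U ** diag_matrix v ** adjoint_matrix U \<in> span (range (matrix_power ?A))" for v
    by (rule diagonal_in_span_powers[OF U(1) u(2,3)])
  have 1: "scalar_matrix c ** H = U ** diag_matrix (\<lambda>i. c * w i) ** adjoint_matrix U" for c
  proof -
    have "scalar_matrix c ** H = (scalar_matrix c ** U) ** diag_matrix w ** adjoint_matrix U"
      by (simp only: U(2) matrix_mul_assoc)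
    also have "\<dots> = U ** (scalar_matrix c ** diag_matrix w) ** adjoint_matrix U"
      by (simp only: matrix_mul_assoc flip: scalar_matrix_commute[of U])
    finally show ?thesis by (simp only: diag_matrix_mult)
  qed
  have "scalar_matrix c \<in> span (range (matrix_power ?A))" for c
    using span[of "\<lambda>_. c"] by (simp only: scalar_matrix_conj[OF U(1)])
  moreover have "?A \<in> SU"
    using U(1) u(1) by (simp add: SU_mult SU_adjoint diag_matrix_in_SU)
  ultimately show ?thesis using span unfolding 1 by blast
qed

lemma span_SU: "span SU = (UNIV :: (complex^'n^'n) set)"
proof -
  have *: "scalar_matrix c ** H \<in> span SU" if H: "adjoint_matrix H = H" for c and H :: "complex^'n^'n"
  proof -
    obtain A where A: "A \<in> SU" "scalar_matrix c ** H \<in> span (range (matrix_power A))"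
      using hermitian_in_span_powers[OF H] by blast
    have "range (matrix_power A) \<subseteq> SU" using SU_matrix_power[OF A(1)] by blast
    then show ?thesis using A(2) span_mono by blast
  qed
  have "M \<in> span SU" for M :: "complex^'n^'n"
  proof -
    obtain H K where HK: "adjoint_matrix H = H" "adjoint_matrix K = K" "M = H + scalar_matrix \<i> ** K"
      using hermitian_decomposition by blast
    have "H \<in> span SU" using *[OF HK(1), of 1] by (simp add: diag_matrix_one)
    then show ?thesis unfolding HK(3) using *[OF HK(2)] by (rule span_add)
  qed
  then show ?thesis by blast
qed

text \<open>Prescribe \<open>L\<close> on a real basis chosen inside \<open>SU\<close>. For any
  other \<open>A\<close> in \<open>SU\<close> the squared norm of \<open>L A - \<phi> A\<close>
  expands into inner products all equal to that of \<open>A\<close> with itself, and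
  cancels.\<close>

lemma linear_extension_exists: "\<exists>L. linear L \<and> (\<forall>A\<in>SU. L A = \<phi> A) \<and> (\<forall>X Y. L X \<bullet> L Y = X \<bullet> Y)"
proof -
  obtain B :: "(complex^'n^'n) set" where B: "B \<subseteq> SU" "independent B" "SU \<subseteq> span B"
    using maximal_independent_subset[of SU] by blast
  then obtain L where L: "linear L" "\<And>A. A \<in> B \<Longrightarrow> L A = \<phi> A"
    using linear_independent_extend[OF B(2), of \<phi>] by blast
  have all: "X \<in> span B" for X
    using B(3) span_SU span_mono[OF B(3)] by (metis UNIV_I span_span subsetD)
  have 1: "L X \<bullet> \<phi> A = X \<bullet> A" if "A \<in> SU" for X A
  proof (rule span_induct[OF all[of X]])
    show "subspace {X. L X \<bullet> \<phi> A = X \<bullet> A}"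
      by (rule subspaceI) (simp_all add: linear_0[OF L(1)] linear_add[OF L(1)] linear_cmul[OF L(1)]
          inner_add_left)
    show "L X \<bullet> \<phi> A = X \<bullet> A" if "X \<in> B" for X
      using that B(1) L(2) inner \<open>A \<in> SU\<close> by auto
  qed
  have 2: "L X \<bullet> L Y = X \<bullet> Y" for X Y
  proof (rule span_induct[OF all[of Y]])
    show "subspace {Y. L X \<bullet> L Y = X \<bullet> Y}"
      by (rule subspaceI) (simp_all add: linear_0[OF L(1)] linear_add[OF L(1)] linear_cmul[OF L(1)]
          inner_add_right)
    show "L X \<bullet> L Y = X \<bullet> Y" if "Y \<in> B" for Y
      using that B(1) L(2) 1 by auto
  qed
  have "L A = \<phi> A" if "A \<in> SU" for A
  proof -
    have "(L A - \<phi> A) \<bullet> (L A - \<phi> A) = 0"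
      using 1[OF that, of A] 2[of A A] inner[OF that that] by (simp add: inner_diff_left inner_diff_right inner_commute)
    then show ?thesis by simp
  qed
  then show ?thesis using L(1) 2 by blast
qed

end

section \<open>Multiplicativity of the linear extension\<close>

locale SU_local_automorphism_extension = SU_local_automorphism \<phi>
  for \<phi> :: "complex^'n^'n \<Rightarrow> complex^'n^'n" +
  fixes L :: "complex^'n^'n \<Rightarrow> complex^'n^'n"
  assumes lin: "linear L" and extends: "A \<in> SU \<Longrightarrow> L A = \<phi> A" and isometric: "L X \<bullet> L Y = X \<bullet> Y"
begin

lemma L_inj: "inj L"
proof (rule linear_injective_0[OF lin, THEN iffD2], intro allI impI)
  fix X assume "L X = 0"
  then show "X = 0" using isometric[of X X] by simp
qed

lemma L_surj: "surj L"
  using linear_injective_imp_surjective[OF lin] L_inj by blast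

lemma L_one: "L (mat 1) = mat 1"
  using extends[OF SU_one] one by simp

text \<open>Compatibility of \<open>\<phi>\<close> with powers extends bilinearly to the real
  algebra generated by \<open>A\<close>.\<close>

lemma L_mult_in_span_powers:
  assumes A: "A \<in> SU" and X: "X \<in> span (range (matrix_power A))" and Y: "Y \<in> span (range (matrix_power A))"
  shows "L (X ** Y) = L X ** L Y"
proof -
  note lin_simps = linear_0[OF lin] linear_add[OF lin] linear_cmul[OF lin]
  have LA: "L (matrix_power A k) = matrix_power (\<phi> A) k" for k
    using extends[OF SU_matrix_power[OF A]] power[OF A] by simp
  have 1: "L (X ** matrix_power A k) = L X ** L (matrix_power A k)" for k
  proof (rule span_induct[OF X])
    show "subspace {X. L (X ** matrix_power A k) = L X ** L (matrix_power A k)}"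
      by (rule subspaceI) (simp_all add: lin_simps matrix_distribs scaleR_matrix_mult zero_matrix_mult)
    show "L (Z ** matrix_power A k) = L Z ** L (matrix_power A k)"
      if "Z \<in> range (matrix_power A)" for Z
      using that by (auto simp: LA simp flip: matrix_power_add)
  qed
  show ?thesis
  proof (rule span_induct[OF Y])
    show "subspace {Y. L (X ** Y) = L X ** L Y}"
      by (rule subspaceI) (simp_all add: lin_simps matrix_distribs scaleR_matrix_mult zero_matrix_mult)
    show "L (X ** Z) = L X ** L Z" if "Z \<in> range (matrix_power A)" for Z
      using that 1 by auto
  qed
qed

lemma L_scalar_mult_hermitian:
  assumes "adjoint_matrix H = H"
  shows "L (scalar_matrix c ** (scalar_matrix d ** H)) = L (scalar_matrix c) ** L (scalar_matrix d ** H)"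
    "L ((scalar_matrix d ** H) ** scalar_matrix c) = L (scalar_matrix d ** H) ** L (scalar_matrix c)"
  using hermitian_in_span_powers[OF assms] L_mult_in_span_powers by meson+

text \<open>A substitute for complex linearity: scalars can be pulled out of \<open>L\<close>, and
  their images commute with all values of \<open>L\<close>. It suffices to check Hermitian parts,
  where a common \<open>A\<close> is available.\<close>

lemma L_scalar_mult:
  "L (scalar_matrix c ** M) = L (scalar_matrix c) ** L M"
  "L (scalar_matrix c) ** L M = L M ** L (scalar_matrix c)"
proof -
  obtain H K where HK: "adjoint_matrix H = H" "adjoint_matrix K = K" "M = scalar_matrix 1 ** H + scalar_matrix \<i> ** K"
    using hermitian_decomposition[of M] by (auto simp: diag_matrix_one)
  show 1: "L (scalar_matrix c ** M) = L (scalar_matrix c) ** L M"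
    by (simp only: HK(3) matrix_distribs linear_add[OF lin] L_scalar_mult_hermitian HK(1,2))
  have "L (M ** scalar_matrix c) = L M ** L (scalar_matrix c)"
    by (simp only: HK(3) matrix_distribs linear_add[OF lin] L_scalar_mult_hermitian HK(1,2))
  then show "L (scalar_matrix c) ** L M = L M ** L (scalar_matrix c)"
    using 1 by (simp add: scalar_matrix_commute)
qed

lemma L_hermitian_square:
  assumes "adjoint_matrix H = H" shows "L (H ** H) = L H ** L H"
proof -
  obtain A where A: "A \<in> SU" "scalar_matrix 1 ** H \<in> span (range (matrix_power A))"
    using hermitian_in_span_powers[OF assms] by blast
  then have "H \<in> span (range (matrix_power A))" by (simp add: diag_matrix_one)
  then show ?thesis using L_mult_in_span_powers[OF A(1)] by blast
qed

lemma L_hermitian_jordan: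
  assumes "adjoint_matrix H = H" "adjoint_matrix K = K"
  shows "L (H ** K + K ** H) = L H ** L K + L K ** L H"
proof -
  have "adjoint_matrix (H + K) = H + K" using assms by (simp add: adjoint_matrix_add)
  then have "L ((H + K) ** (H + K)) = L (H + K) ** L (H + K)" by (rule L_hermitian_square)
  then show ?thesis
    using L_hermitian_square[OF assms(1)] L_hermitian_square[OF assms(2)]
    by (simp add: matrix_distribs linear_add[OF lin] add.commute)
qed

text \<open>Complex bilinearity of both sides reduces the Jordan identity to Hermitian matrices.\<close>

lemma L_jordan: "L (X ** Y + Y ** X) = L X ** L Y + L Y ** L X"
proof -
  let ?i = "scalar_matrix \<i> :: complex^'n^'n"
  have i_left: "L (?i ** X ** Y + Y ** (?i ** X)) = L (?i ** X) ** L Y + L Y ** L (?i ** X)"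
    if "L (X ** Y + Y ** X) = L X ** L Y + L Y ** L X" for X Y
  proof -
    have "?i ** X ** Y + Y ** (?i ** X) = ?i ** (X ** Y + Y ** X)"
      by (simp only: matrix_distribs matrix_mul_assoc scalar_matrix_commute[of Y])
    then have "L (?i ** X ** Y + Y ** (?i ** X)) = L ?i ** (L X ** L Y + L Y ** L X)"
      by (simp only: L_scalar_mult(1) that)
    also have "\<dots> = L ?i ** L X ** L Y + L ?i ** L Y ** L X"
      by (simp only: matrix_distribs matrix_mul_assoc)
    also have "\<dots> = L ?i ** L X ** L Y + L Y ** (L ?i ** L X)"
      by (simp only: L_scalar_mult(2)[of _ Y] matrix_mul_assoc)
    finally show ?thesis by (simp only: L_scalar_mult(1))
  qed
  have sum_left: "L ((X + X') ** Y + Y ** (X + X')) = L (X + X') ** L Y + L Y ** L (X + X')"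
    if "L (X ** Y + Y ** X) = L X ** L Y + L Y ** L X"
      "L (X' ** Y + Y ** X') = L X' ** L Y + L Y ** L X'" for X X' Y
  proof -
    have "L ((X + X') ** Y + Y ** (X + X')) = L (X ** Y + Y ** X) + L (X' ** Y + Y ** X')"
      by (simp add: matrix_distribs linear_add[OF lin])
    also have "\<dots> = L (X + X') ** L Y + L Y ** L (X + X')"
      unfolding that by (simp add: matrix_distribs linear_add[OF lin])
    finally show ?thesis .
  qed
  have swap: "L (Y ** X + X ** Y) = L Y ** L X + L X ** L Y"
    if "L (X ** Y + Y ** X) = L X ** L Y + L Y ** L X" for X Y
    using that by (simp add: add.commute)
  have half: "L (X ** K + K ** X) = L X ** L K + L K ** L X" if K: "adjoint_matrix K = K" for X K
  proof -
    obtain H H' where H: "adjoint_matrix H = H" "adjoint_matrix H' = H'" "X = H + ?i ** H'"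
      using hermitian_decomposition by blast
    show ?thesis unfolding H(3)
      by (intro sum_left i_left L_hermitian_jordan H(1,2) K)
  qed
  obtain K K' where K: "adjoint_matrix K = K" "adjoint_matrix K' = K'" "Y = K + ?i ** K'"
    using hermitian_decomposition by blast
  have "L (Y ** X + X ** Y) = L Y ** L X + L X ** L Y" unfolding K(3)
    by (intro sum_left i_left swap[OF half] K(1,2))
  then show ?thesis by (rule swap)
qed

sublocale jordan: matrix_jordan L
  by (intro matrix_jordan.intro lin L_surj L_jordan)

lemma L_adjoint: "L (adjoint_matrix M) = adjoint_matrix (L M)"
proof -
  have "M \<in> span SU" by (simp add: span_SU)
  then show ?thesis
  proof (rule span_induct)
    show "subspace {M. L (adjoint_matrix M) = adjoint_matrix (L M)}"
      by (rule subspaceI) (simp_all add: linear_0[OF lin] linear_add[OF lin] linear_cmul[OF lin]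
          adjoint_matrix_add adjoint_matrix_scaleR adjoint_matrix_zero)
    show "L (adjoint_matrix A) = adjoint_matrix (L A)" if "A \<in> SU" for A
      using that by (simp add: extends SU_adjoint adjoint)
  qed
qed

text \<open>The Frobenius relation \<open>B A B\<^sup>-\<^sup>1 = A\<^sup>2\<close> with \<open>A\<^sup>7 = 1\<close> distinguishes the two sides: an
  antimultiplicative \<open>L\<close> sends \<open>A\<close> to an element with \<open>A = A\<^sup>4\<close>.\<close>

lemma Frobenius_pair_exists:
  "\<exists>A\<in>SU. \<exists>B\<in>SU. B ** A = A ** A ** B \<and> A ** A ** A \<noteq> (mat 1 :: complex^'n^'n)"
proof -
  obtain S :: "'n set" where "card S = 3" using n obtain_subset_with_card_n by metis
  then obtain i j k :: 'n where ijk: "i \<noteq> j" "i \<noteq> k" "j \<noteq> k" by (auto simp: card_3_iff)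
  define z where "z = cis (2 * pi / 7)"
  have z7: "z ^ 7 = 1" by (simp add: z_def Complex.DeMoivre)
  have z3: "z ^ 3 \<noteq> 1"
  proof
    assume "z ^ 3 = 1"
    then have "z ^ 7 = z" by (simp add: eval_nat_numeral)
    then have "sin (2 * pi / 7) = 0" using z7 by (simp add: z_def complex_eq_iff)
    then show False using sin_gt_zero[of "2 * pi / 7"] by simp
  qed
  have cz: "cmod z = 1" by (simp add: z_def)
  \<comment> \<open>The exponents 1, 2, 4 are an orbit of doubling modulo 7 with sum 7: squaring
    permutes the entries cyclically, and the determinant is one.\<close>
  define u where "u l = (if l = i then z else if l = j then z ^ 2 else if l = k then z ^ 4 else 1)" for l
  have "(\<Prod>l\<in>UNIV. u l) = (\<Prod>l\<in>{i, j, k}. u l)"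
    by (rule prod.mono_neutral_right) (auto simp: u_def)
  also have "\<dots> = z ^ 7" using ijk by (simp add: u_def flip: power_add power_Suc)
  finally have u: "u \<in> torus" using z7 cz by (simp add: torus_def u_def norm_power)
  let ?A = "diag_matrix u"
  \<comment> \<open>Signed transpositions of determinant one; their product is a signed 3-cycle,
    whose signs do not affect the conjugation of diagonal matrices.\<close>
  let ?P = "quaternion_block i j 0 1" and ?Q = "quaternion_block j k 0 1"
  have swap: "quaternion_block a b 0 1 ** diag_matrix v
      = diag_matrix (v \<circ> Transposition.transpose a b) ** quaternion_block a b 0 1"
    if "a \<noteq> b" for a b :: 'n and v
    using that by (auto simp: vec_eq_iff diag_matrix_mult_left diag_matrix_mult_right
        quaternion_block_def Transposition.transpose_def)
  have "(?Q ** ?P) ** ?A = ?Q ** (?P ** ?A)" by (simp add: matrix_mul_assoc)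
  also have "\<dots> = ?Q ** diag_matrix (u \<circ> Transposition.transpose i j) ** ?P"
    by (simp only: swap[OF ijk(1)] matrix_mul_assoc)
  also have "\<dots> = diag_matrix (u \<circ> Transposition.transpose i j \<circ> Transposition.transpose j k) ** (?Q ** ?P)"
    by (simp only: swap[OF ijk(3)] matrix_mul_assoc)
  also have "u \<circ> Transposition.transpose i j \<circ> Transposition.transpose j k = (\<lambda>l. u l * u l)"
  proof
    fix l
    have "z ^ 4 * z ^ 4 = z ^ 7 * z" by (simp flip: power_add power_Suc2)
    then show "(u \<circ> Transposition.transpose i j \<circ> Transposition.transpose j k) l = u l * u l"
      using ijk z7 by (auto simp: u_def Transposition.transpose_def simp flip: power_add power2_eq_square)
  qed
  finally have rel: "(?Q ** ?P) ** ?A = ?A ** ?A ** (?Q ** ?P)" by (simp only: diag_matrix_mult)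
  have "(?A ** ?A ** ?A) $ i $ i = z ^ 3"
    by (simp add: diag_matrix_mult) (simp add: diag_matrix_def u_def eval_nat_numeral)
  then have "?A ** ?A ** ?A \<noteq> mat 1" using z3 by (auto simp: mat_def)
  moreover have "?A \<in> SU" using u by (simp add: diag_matrix_in_SU)
  moreover have "?Q ** ?P \<in> SU" by (intro SU_mult quaternion_block_SU ijk) simp_all
  ultimately show ?thesis using rel by blast
qed

lemma L_mult: "L (X ** Y) = L X ** L Y"
proof (rule ccontr)
  assume "L (X ** Y) \<noteq> L X ** L Y"
  then have anti: "\<And>A B. L (A ** B) = L B ** L A" using jordan.mult_or_antimult_global by blast
  obtain A B :: "complex^'n^'n" where AB: "A \<in> SU" "B \<in> SU" "B ** A = A ** A ** B" "A ** A ** A \<noteq> mat 1"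
    using Frobenius_pair_exists by blast
  obtain \<psi> where \<psi>: "SU_automorphism \<psi>" "\<phi> A = \<psi> A" "\<phi> B = \<psi> B"
    using pair[OF AB(1,2)] by blast
  interpret \<psi>: SU_automorphism \<psi> by (rule \<psi>(1))
  define a b where "a = \<psi> A" and "b = \<psi> B"
  have ab: "a \<in> SU" "b \<in> SU" using \<psi>.closed AB by (simp_all add: a_def b_def)
  have Lab: "L A = a" "L B = b" using AB(1,2) extends \<psi> by (simp_all add: a_def b_def)
  have 1: "b ** a = a ** a ** b"
    using arg_cong[OF AB(3), of \<psi>] AB(1,2) by (simp add: \<psi>.mult SU_mult a_def b_def)
  have 2: "a ** b = b ** (a ** a)"
    using arg_cong[OF AB(3), of L] by (simp only: anti Lab)
  \<comment> \<open>The automorphism preserves the relation and the antimultiplicative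
    \<open>L\<close> reverses it; moving \<open>b\<close> to the right twice by the former turns the
    latter into a b = a^4 b.\<close>
  have "a ** b = (b ** a) ** a" using 2 by (simp add: matrix_mul_assoc)
  also have "\<dots> = (a ** a ** b) ** a" by (simp only: 1)
  also have "\<dots> = a ** a ** (b ** a)" by (simp only: matrix_mul_assoc)
  also have "\<dots> = a ** a ** (a ** a ** b)" by (simp only: 1)
  also have "\<dots> = a ** (a ** a ** a) ** b" by (simp only: matrix_mul_assoc)
  finally have "adjoint_matrix a ** (a ** b) ** adjoint_matrix b
      = adjoint_matrix a ** (a ** (a ** a ** a) ** b) ** adjoint_matrix b" by simp
  then have "(adjoint_matrix a ** a) ** (b ** adjoint_matrix b)
      = (adjoint_matrix a ** a) ** (a ** a ** a) ** (b ** adjoint_matrix b)"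
    by (simp only: matrix_mul_assoc)
  then have "a ** a ** a = mat 1"
    using SU_adjoint_mult[OF ab(1)] SU_mult_adjoint[OF ab(2)] by simp
  then have "\<psi> (A ** A ** A) = \<psi> (mat 1)"
    using AB(1) by (simp add: \<psi>.mult \<psi>.one SU_mult a_def)
  then have "A ** A ** A = mat 1" using \<psi>.eq_iff AB(1) SU_mult SU_one by metis
  then show False using AB(4) by simp
qed

text \<open>The image of i is central because \<open>L\<close> is surjective, hence scalar, and it
  squares to -1. Real linearity then determines \<open>L\<close> on all scalars.\<close>

lemma L_scalar: "\<exists>d. (d = c \<or> d = cnj c) \<and> L (scalar_matrix c) = scalar_matrix d"
proof -
  let ?J = "L (scalar_matrix \<i>)"
  have "?J ** M = M ** ?J" for M using L_scalar_mult(2)[of \<i>] L_surj by (metis surjD)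
  then obtain j where j: "?J = scalar_matrix j" using central_matrix_scalar by blast
  have ii: "scalar_matrix \<i> ** scalar_matrix \<i> = (- 1 *\<^sub>R mat 1 :: complex^'n^'n)"
    by (simp add: diag_matrix_mult) (simp add: diag_matrix_def mat_def vec_eq_iff)
  have "(scalar_matrix j :: complex^'n^'n) ** scalar_matrix j = L (scalar_matrix \<i> ** scalar_matrix \<i>)"
    by (simp only: L_mult j)
  also have "\<dots> = L (- 1 *\<^sub>R mat 1)" by (simp only: ii)
  also have "\<dots> = - 1 *\<^sub>R mat 1" by (simp only: linear_cmul[OF lin] L_one)
  also have "\<dots> = scalar_matrix (- 1)"
    by (simp add: diag_matrix_def mat_def vec_eq_iff)
  finally have "j * j = -1" by (simp add: diag_matrix_mult fun_eq_iff)
  then have "j\<^sup>2 = \<i>\<^sup>2" by (simp add: power2_eq_square)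
  then have ji: "j = \<i> \<or> j = - \<i>" by (simp only: power2_eq_iff)
  have decomp: "scalar_matrix (of_real (Re c) * 1 + of_real (Im c) * e) = Re c *\<^sub>R mat 1 + Im c *\<^sub>R scalar_matrix e" for e
    by (simp only: diag_matrix_add diag_matrix_scaleR diag_matrix_one)
  have "L (scalar_matrix (of_real (Re c) * 1 + of_real (Im c) * \<i>)) = scalar_matrix (of_real (Re c) * 1 + of_real (Im c) * j)"
    unfolding decomp by (simp only: linear_add[OF lin] linear_cmul[OF lin] L_one j)
  moreover have "of_real (Re c) * 1 + of_real (Im c) * \<i> = c" by (simp add: complex_eq_iff)
  moreover have "of_real (Re c) * 1 + of_real (Im c) * j = c \<or> of_real (Re c) * 1 + of_real (Im c) * j = cnj c"
    using ji by (auto simp: complex_eq_iff)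
  ultimately show ?thesis by metis
qed

text \<open>The \<open>L\<close>-preimage \<open>X\<close> of \<open>B\<close> is unitary since
  \<open>L\<close> respects products and adjoints. Writing \<open>X\<close> as a scalar
  \<open>c\<close> times \<open>Y\<close> in \<open>SU\<close>, the scalar image \<open>d\<close> is
  \<open>c\<close> or its conjugate, and comparing determinants in \<open>B\<close> gives d^n = 1,
  hence c^n = 1, which is the determinant of \<open>X\<close>.\<close>

lemma \<phi>_surj:
  assumes B: "B \<in> SU" shows "\<exists>A\<in>SU. \<phi> A = B"
proof -
  obtain X where X: "B = L X" using L_surj by (metis surjD)
  have "L (adjoint_matrix X ** X) = L (mat 1)"
    using SU_adjoint_mult[OF B] by (simp add: L_mult L_adjoint X L_one)
  then have "adjoint_matrix X ** X = mat 1" using L_inj by (simp add: inj_eq)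
  then have U: "unitary_matrix X" by (rule unitary_matrixI)
  obtain c where c: "cmod c = 1" "c ^ CARD('n) = det X"
    using exists_complex_unit_root[OF cmod_det_unitary[OF U], of "CARD('n)"] by auto
  have cc: "cnj c * c = 1" using c(1) cmod_1_iff by blast
  define Y where "Y = scalar_matrix (cnj c) ** X"
  have "det Y = (cnj c * c) ^ CARD('n)"
    by (simp add: Y_def det_mul det_diag_matrix c(2) power_mult_distrib)
  moreover have "unitary_matrix Y"
    unfolding Y_def by (intro unitary_matrix_mult U) (simp add: unitary_diag_matrix c)
  ultimately have Y: "Y \<in> SU" by (simp add: SU_iff cc)
  have XY: "X = scalar_matrix c ** Y"
    using cc by (simp add: Y_def matrix_mul_assoc diag_matrix_mult mult.commute diag_matrix_one)
  obtain d where d: "d = c \<or> d = cnj c" "L (scalar_matrix c) = scalar_matrix d" using L_scalar by blast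
  have "B = scalar_matrix d ** \<phi> Y" by (simp only: X XY L_mult d(2) extends[OF Y])
  then have "det B = d ^ CARD('n) * det (\<phi> Y)" by (simp add: det_mul det_diag_matrix)
  then have "d ^ CARD('n) = 1" using B closed[OF Y] by (simp add: SU_iff)
  then have "c ^ CARD('n) = 1"
    using d(1) by (metis complex_cnj_cnj complex_cnj_one complex_cnj_power)
  then have "X \<in> SU" using U c(2) by (simp add: SU_iff)
  then show ?thesis using X extends by metis
qed

lemma \<phi>_iso: "\<phi> \<in> iso special_unitary_group special_unitary_group"
proof -
  have "\<phi> (A ** B) = \<phi> A ** \<phi> B" if "A \<in> SU" "B \<in> SU" for A B
    using L_mult[of A B] that by (simp add: extends SU_mult)
  moreover have "inj_on \<phi> SU"
    by (rule inj_onI) (metis extends L_inj injD)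
  moreover have "\<phi> ` SU = SU" using closed \<phi>_surj by blast
  ultimately show ?thesis using closed by (auto simp: iso_def hom_def bij_betw_def)
qed

end

theorem theorem3p10:
  fixes \<phi> :: "complex^'n^'n \<Rightarrow> complex^'n^'n"
  assumes "CARD('n) \<ge> 3"
    and "local_automorphism special_unitary_group \<phi>"
  shows "\<phi> \<in> iso special_unitary_group special_unitary_group"
proof -
  interpret SU_local_automorphism \<phi> using assms by unfold_locales
  obtain L where "linear L" "\<forall>A\<in>SU. L A = \<phi> A" "\<forall>X Y. L X \<bullet> L Y = X \<bullet> Y"
    using linear_extension_exists by blast
  then interpret SU_local_automorphism_extension \<phi> L
    by (intro SU_local_automorphism_extension.intro SU_local_automorphism_extension_axioms.intro
        SU_local_automorphism_axioms) auto
  show ?thesis by (rule \<phi>_iso)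
qed

end
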